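(* Let $X$ be a non-empty topological space. The following are equivalent: (a) $X$ is a quasi-ray space. (b) Alice has a winning strategy in $\mathrm{QuasiRayGame}(X)$.
   Context: Trees. A tree is a partially ordered set $(T,\le)$ with a minimum (its root) such that $\{s\in T:s\le t\}$ is well-ordered for every $t\in T$. A ray of $T$ is a non-empty downward closed chain of $T$ with no maximal element; $\mathcal R(T)$ is the set of all rays with the subspace topology inherited from the power set $\mathcal P(T)\simeq2^T$ (product topology). A space is a ray space if it is homeomorphic to $\mathcal R(T)$ for some tree $T$. A space $(X,\tau)$ is a quasi-ray space if there is a topology $\tau'\subseteq\tau$ such that $(X,\tau')$ is a ray space. The game. A partition of a set is a pairwise disjoint collection of non-empty sets whose union is that set; it is open (clopen) if its members are. For a non-empty space $X$, $\mathrm{QuasiRayGame}(X)$ is a transfinite game between Alice and Bob. In inning $0$, Alice chooses an open partition $\mathcal P_0$ of $X$ and Bob picks $U_0\in\mathcal P_0$. In a successor inning $\alpha=\beta+1$, Alice chooses a clopen partition $\mathcal P_{\beta+1}$ of $U_\beta$ and Bob picks $U_{\beta+1}\in\mathcal P_{\beta+1}$. In a (nonzero) limit inning $\alpha$: if there exist a pairwise disjoint collection $\mathcal P_\alpha$ of non-empty clopen subsets of $X$ and a point $x_\alpha\in X$ such that $\bigcap_{\beta<\alpha}U_\beta=(\bigcup\mathcal P_\alpha)\sqcup\{x_\alpha\}$ (disjoint union), then Alice chooses one such pair $(\mathcal P_\alpha,x_\alpha)$; if $\mathcal P_\alpha\neq\emptyset$, Bob picks $U_\alpha\in\mathcal P_\alpha$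 and the game continues, while if $\mathcal P_\alpha=\emptyset$ the run ends and Alice wins. If no such pair exists, the run ends and Bob wins. A strategy for Alice is a map assigning to each sequence $(U_\beta:\beta<\alpha)$ of Bob's moves made against it so far a legal move of Alice in inning $\alpha$ whenever she has one; it is winning if every finished run in which Alice follows it is won by Alice. *)

theory Defs
  imports "HOL-Analysis.Analysis"
begin

section \<open>Trees and ray spaces\<close>

definition is_tree :: "'b set \<Rightarrow> 'b rel \<Rightarrow> bool" where
  "is_tree T r \<longleftrightarrow>
     partial_order_on T r \<and>
     (\<exists>m\<in>T. \<forall>t\<in>T. (m, t) \<in> r) \<and>
     (\<forall>t\<in>T. well_order_on {s\<in>T. (s, t) \<in> r} (Restr r {s\<in>T. (s, t) \<in> r}))"

definition is_ray :: "'b set \<Rightarrow> 'b rel \<Rightarrow> 'b set \<Rightarrow> bool" where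
  "is_ray T r R \<longleftrightarrow>
     R \<subseteq> T \<and> R \<noteq> {} \<and>
     (\<forall>t\<in>R. \<forall>s\<in>T. (s, t) \<in> r \<longrightarrow> s \<in> R) \<and>
     (\<forall>s\<in>R. \<forall>t\<in>R. (s, t) \<in> r \<or> (t, s) \<in> r) \<and>
     \<not> (\<exists>m\<in>R. \<forall>t\<in>R. (m, t) \<in> r \<longrightarrow> t = m)"

text \<open>The power set of \<open>T\<close> carries the topology of \<open>2\<^sup>T\<close>, transported along the bijection
  that sends a subset of \<open>T\<close> to its characteristic function.\<close>

definition powerset_topology :: "'b set \<Rightarrow> 'b set topology" where
  "powerset_topology T =
     pullback_topology (Pow T) (\<lambda>A. \<lambda>t\<in>T. t \<in> A)
       (product_topology (\<lambda>_. discrete_topology (UNIV :: bool set)) T)"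

definition ray_topology :: "'b set \<Rightarrow> 'b rel \<Rightarrow> 'b set topology" where
  "ray_topology T r = subtopology (powerset_topology T) {R. is_ray T r R}"

text \<open>HOL cannot quantify existentially over the type of the nodes of a tree, so the nodes are
  taken from \<open>'a \<times> nat\<close>. This is no restriction: by the lemma \<open>ray_spaceI\<close> below, a space that is
  homeomorphic to the ray space of a tree with nodes in any type whatsoever is a ray space in
  the sense of this definition.\<close>

definition ray_space :: "'a topology \<Rightarrow> bool" where
  "ray_space X \<longleftrightarrow>
     (\<exists>(T :: ('a \<times> nat) set) r. is_tree T r \<and> X homeomorphic_space ray_topology T r)"

lemma topspace_ray_topology [simp]: "topspace (ray_topology T r) = {R. is_ray T r R}"
  by (auto simp: ray_topology_def powerset_topology_def topspace_pullback_topology is_ray_def)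

lemma continuous_map_ray_coordinate:
  assumes "t \<in> T"
  shows "continuous_map (ray_topology T r) (discrete_topology (UNIV :: bool set)) (\<lambda>R. t \<in> R)"
proof -
  have "continuous_map (powerset_topology T) (discrete_topology (UNIV :: bool set))
          ((\<lambda>x. x t) \<circ> (\<lambda>A. \<lambda>t\<in>T. t \<in> A))"
    unfolding powerset_topology_def
    by (intro continuous_map_pullback continuous_map_product_projection assms)
  then show ?thesis
    using assms by (simp add: ray_topology_def o_def continuous_map_from_subtopology)
qed

lemma continuous_map_into_ray_topology:
  assumes ray: "\<And>x. x \<in> topspace X \<Longrightarrow> is_ray T r (f x)"
    and cont: "\<And>t. t \<in> T \<Longrightarrow>
      continuous_map X (discrete_topology (UNIV :: bool set)) (\<lambda>x. t \<in> f x)"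
  shows "continuous_map X (ray_topology T r) f"
proof -
  have "continuous_map X (powerset_topology T) f"
    unfolding powerset_topology_def
  proof (rule continuous_map_pullback')
    show "continuous_map X (product_topology (\<lambda>_. discrete_topology (UNIV :: bool set)) T)
            ((\<lambda>A. \<lambda>t\<in>T. t \<in> A) \<circ> f)"
      unfolding continuous_map_componentwise using cont by (auto simp: o_def)
    show "topspace X \<subseteq> f -` Pow T"
      using ray by (auto simp: is_ray_def)
  qed
  then show ?thesis
    using ray by (auto simp: ray_topology_def continuous_map_in_subtopology)
qed

text \<open>An isomorphism onto \<open>T'\<close> of a part \<open>S\<close> of \<open>T\<close> that contains all the rays of \<open>T\<close>.\<close>

lemma ray_topology_homeomorphic:
  assumes S: "S \<subseteq> T" "\<And>R. is_ray T r R \<Longrightarrow> R \<subseteq> S"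
    and down: "\<And>s t. \<lbrakk>s \<in> T; t \<in> S; (s, t) \<in> r\<rbrakk> \<Longrightarrow> s \<in> S"
    and f: "bij_betw f S T'"
    and iso: "\<And>s t. \<lbrakk>s \<in> S; t \<in> S\<rbrakk> \<Longrightarrow> (f s, f t) \<in> r' \<longleftrightarrow> (s, t) \<in> r"
  shows "ray_topology T r homeomorphic_space ray_topology T' r'"
proof -
  let ?\<phi> = "\<lambda>R. f ` R" and ?\<psi> = "\<lambda>R. {t\<in>S. f t \<in> R}"
  have inj: "inj_on f S" and T': "T' = f ` S"
    using f by (auto simp: bij_betw_def)
  have ray1: "is_ray T' r' (f ` R)" if R: "is_ray T r R" for R
  proof -
    have RS: "R \<subseteq> S" using S R by blast
    show ?thesis
      unfolding is_ray_def
    proof (intro conjI)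
      show "f ` R \<subseteq> T'" "f ` R \<noteq> {}" using RS R T' by (auto simp: is_ray_def)
      show "\<forall>t\<in>f ` R. \<forall>s\<in>T'. (s, t) \<in> r' \<longrightarrow> s \<in> f ` R"
      proof (intro ballI impI)
        fix x y assume "x \<in> f ` R" "y \<in> T'" "(y, x) \<in> r'"
        then obtain t s where ts: "t \<in> R" "x = f t" "s \<in> S" "y = f s" unfolding T' by auto
        with \<open>(y, x) \<in> r'\<close> have "(s, t) \<in> r" using iso[of s t] RS by auto
        with ts S(1) R have "s \<in> R" unfolding is_ray_def by auto
        with ts show "y \<in> f ` R" by blast
      qed
      show "\<forall>s\<in>f ` R. \<forall>t\<in>f ` R. (s, t) \<in> r' \<or> (t, s) \<in> r'"
      proof (intro ballI)
        fix x y assume "x \<in> f ` R" "y \<in> f ` R"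
        then obtain s t where st: "s \<in> R" "x = f s" "t \<in> R" "y = f t" by auto
        then have "(s, t) \<in> r \<or> (t, s) \<in> r" using R by (auto simp: is_ray_def)
        then show "(x, y) \<in> r' \<or> (y, x) \<in> r'"
          using st RS iso[of s t] iso[of t s] by auto
      qed
      show "\<not> (\<exists>m\<in>f ` R. \<forall>t\<in>f ` R. (m, t) \<in> r' \<longrightarrow> t = m)"
      proof
        assume "\<exists>m\<in>f ` R. \<forall>t\<in>f ` R. (m, t) \<in> r' \<longrightarrow> t = m"
        then obtain m where m: "m \<in> R" "\<forall>t\<in>R. (f m, f t) \<in> r' \<longrightarrow> f t = f m" by auto
        then have "\<forall>t\<in>R. (m, t) \<in> r \<longrightarrow> t = m"
          using iso RS inj by (metis inj_onD subsetD)
        with m R show False unfolding is_ray_def by blast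
      qed
    qed
  qed
  have ray2: "is_ray T r {t\<in>S. f t \<in> R}" if R: "is_ray T' r' R" for R
    unfolding is_ray_def
  proof (intro conjI)
    have RT: "R \<subseteq> f ` S" using R T' by (auto simp: is_ray_def)
    show "{t\<in>S. f t \<in> R} \<subseteq> T" using S by auto
    show "{t\<in>S. f t \<in> R} \<noteq> {}" using R RT by (auto simp: is_ray_def)
    show "\<forall>t\<in>{t\<in>S. f t \<in> R}. \<forall>s\<in>T. (s, t) \<in> r \<longrightarrow> s \<in> {t\<in>S. f t \<in> R}"
    proof (intro ballI impI)
      fix t s assume ts: "t \<in> {t\<in>S. f t \<in> R}" "s \<in> T" "(s, t) \<in> r"
      then have "s \<in> S" using down[of s t] by simp
      with ts iso[of s t] T' have "(f s, f t) \<in> r'" "f s \<in> T'" by auto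
      with R ts \<open>s \<in> S\<close> show "s \<in> {t\<in>S. f t \<in> R}" unfolding is_ray_def by auto
    qed
    show "\<forall>s\<in>{t\<in>S. f t \<in> R}. \<forall>t\<in>{t\<in>S. f t \<in> R}. (s, t) \<in> r \<or> (t, s) \<in> r"
      using R iso unfolding is_ray_def by blast
    show "\<not> (\<exists>m\<in>{t\<in>S. f t \<in> R}. \<forall>t\<in>{t\<in>S. f t \<in> R}. (m, t) \<in> r \<longrightarrow> t = m)"
    proof
      assume "\<exists>m\<in>{t\<in>S. f t \<in> R}. \<forall>t\<in>{t\<in>S. f t \<in> R}. (m, t) \<in> r \<longrightarrow> t = m"
      then obtain m where m: "m \<in> S" "f m \<in> R"
        "\<And>t. \<lbrakk>t \<in> S; f t \<in> R; (m, t) \<in> r\<rbrakk> \<Longrightarrow> t = m" by auto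
      have "u = f m" if u: "u \<in> R" "(f m, u) \<in> r'" for u
      proof -
        obtain t where "t \<in> S" "u = f t" using RT u by auto
        with m(3)[of t] u iso[OF m(1), of t] show ?thesis by simp
      qed
      with m R show False unfolding is_ray_def by blast
    qed
  qed
  have "homeomorphic_maps (ray_topology T r) (ray_topology T' r') ?\<phi> ?\<psi>"
    unfolding homeomorphic_maps_def
  proof (intro conjI)
    show "continuous_map (ray_topology T r) (ray_topology T' r') ?\<phi>"
    proof (rule continuous_map_into_ray_topology)
      fix t' assume "t' \<in> T'"
      then obtain t where t: "t \<in> S" "t' = f t" using T' by auto
      have "continuous_map (ray_topology T r) (discrete_topology UNIV) (\<lambda>R. t \<in> R)"
        using t(1) S(1) by (intro continuous_map_ray_coordinate) (rule subsetD)
      then show "continuous_map (ray_topology T r) (discrete_topology UNIV) (\<lambda>R. t' \<in> f ` R)"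
      proof (rule continuous_map_eq)
        fix R assume "R \<in> topspace (ray_topology T r)"
        then have "R \<subseteq> S" using S(2) by simp
        then show "(t \<in> R) = (t' \<in> f ` R)" using t inj_on_image_mem_iff[OF inj] by blast
      qed
    qed (use ray1 in auto)
    show "continuous_map (ray_topology T' r') (ray_topology T r) ?\<psi>"
    proof (rule continuous_map_into_ray_topology)
      fix t assume "t \<in> T"
      show "continuous_map (ray_topology T' r') (discrete_topology UNIV)
              (\<lambda>R. t \<in> {t\<in>S. f t \<in> R})"
      proof (cases "t \<in> S")
        case True
        then show ?thesis using continuous_map_ray_coordinate[of "f t" T' r'] T' by simp
      qed simp
    qed (use ray2 in auto)
    show "\<forall>R\<in>topspace (ray_topology T r). ?\<psi> (?\<phi> R) = R"
    proof
      fix R assume "R \<in> topspace (ray_topology T r)"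
      then have "R \<subseteq> S" using S(2) by simp
      then show "?\<psi> (?\<phi> R) = R" using inj_on_image_mem_iff[OF inj] by blast
    qed
    show "\<forall>R\<in>topspace (ray_topology T' r'). ?\<phi> (?\<psi> R) = R"
    proof
      fix R assume "R \<in> topspace (ray_topology T' r')"
      then have "R \<subseteq> f ` S" using T' by (simp add: is_ray_def)
      then show "?\<phi> (?\<psi> R) = R" by blast
    qed
  qed
  then show ?thesis by (auto simp: homeomorphic_space_def)
qed

lemma is_tree_transport:
  assumes tree: "is_tree T r" and S: "S \<subseteq> T" "S \<noteq> {}"
    and down: "\<And>s t. \<lbrakk>s \<in> T; t \<in> S; (s, t) \<in> r\<rbrakk> \<Longrightarrow> s \<in> S"
    and inj: "inj_on f S" and r': "r' \<subseteq> f ` S \<times> f ` S"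
    and iso: "\<And>s t. \<lbrakk>s \<in> S; t \<in> S\<rbrakk> \<Longrightarrow> (f s, f t) \<in> r' \<longleftrightarrow> (s, t) \<in> r"
  shows "is_tree (f ` S) r'"
proof -
  have refl: "(t, t) \<in> r" if "t \<in> S" for t
    using tree S(1) that by (auto simp: is_tree_def order_on_defs refl_on_def)
  have "trans r" and "antisym r"
    using tree by (auto simp: is_tree_def order_on_defs)
  have r'E: "\<exists>s\<in>S. \<exists>t\<in>S. x = f s \<and> y = f t \<and> (s, t) \<in> r" if xy: "(x, y) \<in> r'" for x y
  proof -
    obtain s t where "s \<in> S" "t \<in> S" "x = f s" "y = f t" using r' xy by auto
    with xy iso[of s t] show ?thesis by auto
  qed
  have refl': "refl_on (f ` S) r'" using refl iso by (auto simp: refl_on_def)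
  have trans': "trans r'"
  proof (rule transI)
    fix x y z assume xy: "(x, y) \<in> r'" and yz: "(y, z) \<in> r'"
    obtain s t where st: "s \<in> S" "t \<in> S" "x = f s" "y = f t" "(s, t) \<in> r"
      using r'E[OF xy] by auto
    obtain t' u where tu: "t' \<in> S" "u \<in> S" "y = f t'" "z = f u" "(t', u) \<in> r"
      using r'E[OF yz] by auto
    have "t' = t" using st tu inj by (metis inj_onD)
    with st tu \<open>trans r\<close> have "(s, u) \<in> r" by (meson transD)
    with st tu iso[of s u] show "(x, z) \<in> r'" by simp
  qed
  have antisym': "antisym r'"
  proof (rule antisymI)
    fix x y assume xy: "(x, y) \<in> r'" and yx: "(y, x) \<in> r'"
    obtain s t where st: "s \<in> S" "t \<in> S" "x = f s" "y = f t" "(s, t) \<in> r"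
      using r'E[OF xy] by auto
    with yx iso[of t s] have "(t, s) \<in> r" by simp
    with st \<open>antisym r\<close> show "x = y" by (metis antisymD)
  qed
  show ?thesis
    unfolding is_tree_def
  proof (intro conjI ballI)
    show "partial_order_on (f ` S) r'"
      using r' refl' trans' antisym' by (simp add: order_on_defs)
    obtain m where m: "m \<in> T" "\<And>t. t \<in> T \<Longrightarrow> (m, t) \<in> r"
      using tree by (auto simp: is_tree_def)
    obtain t\<^sub>0 where "t\<^sub>0 \<in> S" using S(2) by auto
    with m S(1) down[of m t\<^sub>0] have mS: "m \<in> S" by auto
    have "(f m, f t) \<in> r'" if "t \<in> S" for t
      using iso[OF mS that] m(2)[of t] S(1) that by auto
    with mS show "\<exists>m\<in>f ` S. \<forall>t\<in>f ` S. (m, t) \<in> r'" by auto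
    fix x assume "x \<in> f ` S"
    then obtain t where t: "t \<in> S" "x = f t" by auto
    define A where "A = {s\<in>T. (s, t) \<in> r}"
    define B where "B = {s\<in>f ` S. (s, x) \<in> r'}"
    have wo: "well_order_on A (Restr r A)" using tree t S by (auto simp: is_tree_def A_def)
    have AS: "A \<subseteq> S" using down t by (auto simp: A_def)
    have BA: "y \<in> B \<longleftrightarrow> y \<in> f ` A" for y
    proof
      assume "y \<in> B"
      then obtain s where "s \<in> S" "y = f s" "(f s, f t) \<in> r'" by (auto simp: B_def t)
      with iso[of s t] t S(1) show "y \<in> f ` A" by (auto simp: A_def)
    next
      assume "y \<in> f ` A"
      then obtain s where s: "s \<in> A" "y = f s" by auto
      with AS have "s \<in> S" by auto
      with s iso[of s t] t show "y \<in> B" by (auto simp: A_def B_def)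
    qed
    have "well_order_on B (Restr r' B)"
      unfolding well_order_on_def linear_order_on_def partial_order_on_def preorder_on_def
    proof (intro conjI)
      show "Restr r' B \<subseteq> B \<times> B" by auto
      show "refl_on B (Restr r' B)" using refl' by (auto simp: refl_on_def B_def)
      show "trans (Restr r' B)" using trans' by (rule trans_Restr)
      show "antisym (Restr r' B)" using antisym' by (rule antisym_subset[OF Int_lower1])
      show "total_on B (Restr r' B)"
      proof (rule total_onI)
        fix a b assume ab: "a \<in> B" "b \<in> B" "a \<noteq> b"
        then obtain s u where su: "a = f s" "b = f u" "s \<in> A" "u \<in> A" "s \<noteq> u"
          unfolding BA by auto
        with wo have "(s, u) \<in> r \<or> (u, s) \<in> r"
          by (auto simp: order_on_defs total_on_def)
        with su AS iso[of s u] iso[of u s] have "(a, b) \<in> r' \<or> (b, a) \<in> r'" by auto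
        with ab show "(a, b) \<in> Restr r' B \<or> (b, a) \<in> Restr r' B" by auto
      qed
      have "wf (Restr r A - Id)" using wo by (simp add: well_order_on_def)
      then have "wf (inv_image (Restr r A - Id) (inv_into S f))" by (rule wf_inv_image)
      moreover have "Restr r' B - Id \<subseteq> inv_image (Restr r A - Id) (inv_into S f)"
      proof
        fix p assume p: "p \<in> Restr r' B - Id"
        then obtain a b where ab: "p = (a, b)" "a \<in> B" "b \<in> B" "(a, b) \<in> r'" "a \<noteq> b"
          by auto
        then obtain s u where su: "a = f s" "b = f u" "s \<in> A" "u \<in> A"
          unfolding BA by auto
        with ab AS iso[of s u] have "(s, u) \<in> r" "s \<noteq> u" by auto
        moreover have "inv_into S f (f s) = s" "inv_into S f (f u) = u"
          using inj su AS by (auto intro: inv_into_f_f)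
        ultimately show "p \<in> inv_image (Restr r A - Id) (inv_into S f)"
          using su ab by (auto simp: inv_image_def)
      qed
      ultimately show "wf (Restr r' B - Id)" by (rule wf_subset)
    qed
    then show "well_order_on {s \<in> f ` S. (s, x) \<in> r'} (Restr r' {s \<in> f ` S. (s, x) \<in> r'})"
      by (simp only: B_def)
  qed
qed

text \<open>Truncating a ray through \<open>t\<close> at the first limit level above \<open>t\<close> gives a ray from which \<open>t\<close>
  is determined up to a natural number.\<close>

lemma ray_truncate:
  assumes tree: "is_tree T r" and R: "is_ray T r R" and t: "t \<in> R"
  defines "I \<equiv> \<lambda>t s. {u. (t, u) \<in> r \<and> (u, s) \<in> r}"
  shows "is_ray T r {s\<in>R. finite (I t s)}" (is "is_ray T r ?Q") and "t \<in> {s\<in>R. finite (I t s)}"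
proof -
  have rT: "r \<subseteq> T \<times> T" and refl: "\<And>t. t \<in> T \<Longrightarrow> (t, t) \<in> r" and tr: "trans r"
    and as: "antisym r"
    using tree by (auto simp: is_tree_def order_on_defs refl_on_def)
  have RT: "R \<subseteq> T" and dn: "\<And>s u. \<lbrakk>u \<in> R; (s, u) \<in> r\<rbrakk> \<Longrightarrow> s \<in> R"
    and ch: "\<And>s u. \<lbrakk>s \<in> R; u \<in> R\<rbrakk> \<Longrightarrow> (s, u) \<in> r \<or> (u, s) \<in> r"
    and nomax: "\<And>m. m \<in> R \<Longrightarrow> \<exists>u\<in>R. (m, u) \<in> r \<and> u \<noteq> m"
    using R rT unfolding is_ray_def by blast+
  have "I t t \<subseteq> {t}" using as by (auto simp: I_def dest: antisymD)
  then have "finite (I t t)" by (rule finite_subset) simp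
  with t show tQ: "t \<in> ?Q" by simp
  have nm: "\<exists>u\<in>?Q. (m, u) \<in> r \<and> u \<noteq> m" if m: "m \<in> ?Q" for m
  proof -
    from m nomax obtain v where v: "v \<in> R" "(m, v) \<in> r" "v \<noteq> m" by blast
    let ?A = "{s\<in>T. (s, v) \<in> r}"
    have vT: "v \<in> T" using v RT by blast
    have "wf (Restr r ?A - Id)"
      using tree vT by (auto simp: is_tree_def well_order_on_def)
    moreover have "v \<in> {s\<in>?A. (m, s) \<in> r \<and> s \<noteq> m}" using v vT refl by auto
    ultimately obtain u where u: "u \<in> {s\<in>?A. (m, s) \<in> r \<and> s \<noteq> m}"
      and mn: "\<And>y. (y, u) \<in> Restr r ?A - Id \<Longrightarrow> y \<notin> {s\<in>?A. (m, s) \<in> r \<and> s \<noteq> m}"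
      by (rule wfE_min) blast
    have uR: "u \<in> R" using u v dn by blast
    have "I t u \<subseteq> insert u (I t m)"
    proof
      fix w assume w: "w \<in> I t u"
      then have wu: "(w, u) \<in> r" "(t, w) \<in> r" by (auto simp: I_def)
      show "w \<in> insert u (I t m)"
      proof (cases "w = u")
        case False
        have wR: "w \<in> R" using wu uR dn by blast
        have "(w, v) \<in> r" using wu u tr by (blast dest: transD)
        with wu False u wR RT have "(w, u) \<in> Restr r ?A - Id" by blast
        with mn have "w \<notin> {s\<in>?A. (m, s) \<in> r \<and> s \<noteq> m}" by blast
        with \<open>(w, v) \<in> r\<close> wR RT have "(m, w) \<notin> r \<or> w = m" by blast
        with ch[of w m] wR m refl RT have "(w, m) \<in> r" by blast
        with wu show ?thesis by (auto simp: I_def)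
      qed auto
    qed
    then have "finite (I t u)" using m finite_subset by fastforce
    with u uR show ?thesis by blast
  qed
  show "is_ray T r ?Q"
    unfolding is_ray_def
  proof (intro conjI)
    show "?Q \<subseteq> T" using RT by auto
    show "?Q \<noteq> {}" using tQ by blast
    show "\<forall>s\<in>?Q. \<forall>u\<in>T. (u, s) \<in> r \<longrightarrow> u \<in> ?Q"
    proof (intro ballI impI)
      fix s u assume s: "s \<in> ?Q" "(u, s) \<in> r"
      have "I t u \<subseteq> I t s" using s tr by (auto simp: I_def dest: transD)
      with s show "u \<in> ?Q" using dn finite_subset by blast
    qed
    show "\<forall>s\<in>?Q. \<forall>t\<in>?Q. (s, t) \<in> r \<or> (t, s) \<in> r" using ch by blast
    show "\<not> (\<exists>m\<in>?Q. \<forall>t\<in>?Q. (m, t) \<in> r \<longrightarrow> t = m)" using nm by blast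
  qed
qed

lemma ray_nodes_inj:
  assumes tree: "is_tree T r"
  obtains Q :: "'b \<Rightarrow> 'b set" and n :: "'b \<Rightarrow> nat"
  where "\<And>t. t \<in> \<Union>{R. is_ray T r R} \<Longrightarrow> is_ray T r (Q t)"
    and "inj_on (\<lambda>t. (Q t, n t)) (\<Union>{R. is_ray T r R})"
proof -
  define S where "S = \<Union>{R. is_ray T r R}"
  define I where "I = (\<lambda>t s. {u. (t, u) \<in> r \<and> (u, s) \<in> r})"
  have rT: "r \<subseteq> T \<times> T" and refl: "\<And>t. t \<in> T \<Longrightarrow> (t, t) \<in> r" and tr: "trans r"
    and as: "antisym r"
    using tree by (auto simp: is_tree_def order_on_defs refl_on_def)
  have "\<exists>R. is_ray T r R \<and> t \<in> R \<and> (\<forall>s\<in>R. finite (I t s))" if "t \<in> S" for t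
  proof -
    from that obtain R where R: "is_ray T r R" "t \<in> R" by (auto simp: S_def)
    show ?thesis
      using ray_truncate[OF tree R] unfolding I_def by blast
  qed
  then obtain Q where Q: "\<And>t. t \<in> S \<Longrightarrow> is_ray T r (Q t)" "\<And>t. t \<in> S \<Longrightarrow> t \<in> Q t"
    "\<And>t s. \<lbrakk>t \<in> S; s \<in> Q t\<rbrakk> \<Longrightarrow> finite (I t s)"
    by metis
  define B where "B = (\<lambda>t. {u\<in>S. Q u = Q t \<and> (u, t) \<in> r})"
  have fin: "finite (B t)" if t: "t \<in> S" for t
  proof -
    have tT: "t \<in> T" using t by (auto simp: S_def is_ray_def)
    let ?A = "{s\<in>T. (s, t) \<in> r}"
    have "wf (Restr r ?A - Id)"
      using tree tT by (auto simp: is_tree_def well_order_on_def)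
    moreover have "t \<in> B t" using t tT refl by (auto simp: B_def)
    ultimately obtain m where m: "m \<in> B t"
      and mn: "\<And>y. (y, m) \<in> Restr r ?A - Id \<Longrightarrow> y \<notin> B t"
      by (rule wfE_min) blast
    have "B t \<subseteq> I m t"
    proof
      fix u assume u: "u \<in> B t"
      have "u \<in> Q t" "m \<in> Q t" using u m Q(2) by (auto simp: B_def)
      with Q(1)[OF t] have "(m, u) \<in> r \<or> (u, m) \<in> r" by (auto simp: is_ray_def)
      moreover have "(u, m) \<notin> Restr r ?A - Id" using mn u by blast
      ultimately have "(m, u) \<in> r"
        using u m rT refl by (auto simp: B_def)
      with u show "u \<in> I m t" by (auto simp: B_def I_def)
    qed
    moreover have "finite (I m t)"
      using m Q(3)[of m t] Q(2)[OF t] by (auto simp: B_def)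
    ultimately show ?thesis by (rule finite_subset)
  qed
  have lt: "card (B s) < card (B t)"
    if st: "s \<in> S" "t \<in> S" "Q s = Q t" "(s, t) \<in> r" "s \<noteq> t" for s t
  proof (rule psubset_card_mono[OF fin])
    have "B s \<subseteq> B t" using st tr by (auto simp: B_def dest: transD)
    moreover have "t \<in> B t" using st rT refl by (auto simp: B_def)
    moreover have "t \<notin> B s" using st as by (auto simp: B_def dest: antisymD)
    ultimately show "B s \<subset> B t" by blast
  qed (use st in auto)
  show thesis
  proof
    show "\<And>t. t \<in> \<Union>{R. is_ray T r R} \<Longrightarrow> is_ray T r (Q t)" using Q(1) unfolding S_def .
    show "inj_on (\<lambda>t. (Q t, card (B t))) (\<Union>{R. is_ray T r R})"
      unfolding S_def[symmetric]
    proof (rule inj_onI, rule ccontr)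
      fix s t assume st: "s \<in> S" "t \<in> S" "(Q s, card (B s)) = (Q t, card (B t))" "s \<noteq> t"
      then have "s \<in> Q t" "t \<in> Q t" using Q(2) by auto
      with Q(1)[OF st(2)] have "(s, t) \<in> r \<or> (t, s) \<in> r" by (auto simp: is_ray_def)
      with st lt[of s t] lt[of t s] show False by auto
    qed
  qed
qed

lemma ray_spaceI:
  fixes X :: "'a topology" and T :: "'b set"
  assumes tree: "is_tree T r" and X: "X homeomorphic_space ray_topology T r"
  shows "ray_space X"
proof -
  define S where "S = \<Union>{R. is_ray T r R}"
  have SR: "\<And>R. is_ray T r R \<Longrightarrow> R \<subseteq> S" by (auto simp: S_def)
  have ST: "S \<subseteq> T" by (auto simp: S_def is_ray_def)
  have down: "\<And>s t. \<lbrakk>s \<in> T; t \<in> S; (s, t) \<in> r\<rbrakk> \<Longrightarrow> s \<in> S"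
    unfolding S_def is_ray_def by blast
  show ?thesis
  proof (cases "S = {}")
    case True
    then have "\<not> is_ray T r R" for R by (auto simp: S_def is_ray_def)
    then have e: "ray_topology T r = trivial_topology"
      by (simp flip: null_topspace_iff_trivial)
    let ?T = "{undefined :: 'a \<times> nat}" and ?r = "{(undefined, undefined)} :: ('a \<times> nat) rel"
    have "is_tree ?T ?r"
      by (auto simp: is_tree_def order_on_defs refl_on_def trans_def antisym_def total_on_def)
    moreover have "\<not> is_ray ?T ?r R" for R
      unfolding is_ray_def by blast
    then have "ray_topology ?T ?r = trivial_topology"
      by (simp flip: null_topspace_iff_trivial)
    ultimately show ?thesis
      using X e unfolding ray_space_def
      by (metis homeomorphic_empty_space homeomorphic_empty_space_eq)
  next
    case False
    obtain Q n where Q: "\<And>t. t \<in> S \<Longrightarrow> is_ray T r (Q t)"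
      and inj: "inj_on (\<lambda>t. (Q t, n t :: nat)) S"
      using ray_nodes_inj[OF tree] unfolding S_def by metis
    obtain g h where gh: "homeomorphic_maps X (ray_topology T r) g h"
      using X by (auto simp: homeomorphic_space_def)
    then have hinj: "\<And>R. is_ray T r R \<Longrightarrow> g (h R) = R"
      by (simp add: homeomorphic_maps_def)
    define f where "f = (\<lambda>t. (h (Q t), n t))"
    have finj: "inj_on f S"
    proof (rule inj_onI)
      fix s t assume "s \<in> S" "t \<in> S" "f s = f t"
      then show "s = t"
        using inj Q hinj by (auto simp: f_def inj_on_def) (metis)
    qed
    define r' where "r' = {(f s, f t) | s t. s \<in> S \<and> t \<in> S \<and> (s, t) \<in> r}"
    have r': "r' \<subseteq> f ` S \<times> f ` S" by (auto simp: r'_def)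
    have iso: "(f s, f t) \<in> r' \<longleftrightarrow> (s, t) \<in> r" if "s \<in> S" "t \<in> S" for s t
      using that finj by (auto simp: r'_def dest: inj_onD)
    have "is_tree (f ` S) r'"
      by (rule is_tree_transport[OF tree ST False down finj r' iso])
    moreover have "ray_topology T r homeomorphic_space ray_topology (f ` S) r'"
      using finj by (intro ray_topology_homeomorphic[OF ST SR down _ iso])
        (auto simp: bij_betw_def)
    ultimately show ?thesis
      using X homeomorphic_space_trans unfolding ray_space_def by blast
  qed
qed

definition quasi_ray_space :: "'a topology \<Rightarrow> bool" where
  "quasi_ray_space X \<longleftrightarrow>
     (\<exists>X'. topspace X' = topspace X \<and> (\<forall>U. openin X' U \<longrightarrow> openin X U) \<and> ray_space X')"


section \<open>Innings\<close>

text \<open>The innings are the ordinals below the cardinal successor of \<open>|'a \<times> nat|\<close>.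
  At a limit inning that does not end the run the point \<open>x\<close> chosen by Alice is lost for good, so
  there are at most \<open>|'a|\<close> such innings, and every run ends at one of the innings represented
  here: see the lemma \<open>run_terminates\<close> below.\<close>

typedef 'a inning = "Field (cardSuc (card_of (UNIV :: ('a \<times> nat) set)))"
proof -
  have "infinite (Field (cardSuc (card_of (UNIV :: ('a \<times> nat) set))))"
    using cardSuc_finite[OF card_of_Card_order, of "UNIV :: ('a \<times> nat) set"]
    by (simp add: Field_card_of finite_prod)
  then show ?thesis by (metis finite.emptyI ex_in_conv)
qed

lemma inning_Well_order: "Well_order (cardSuc (card_of (UNIV :: ('a \<times> nat) set)))"
  by (intro cardSuc_Well_order card_of_Card_order)

instantiation inning :: (type) wellorder
begin

definition less_eq_inning :: "'a inning \<Rightarrow> 'a inning \<Rightarrow> bool" where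
  "\<alpha> \<le> \<beta> \<longleftrightarrow> (Rep_inning \<alpha>, Rep_inning \<beta>) \<in> cardSuc (card_of (UNIV :: ('a \<times> nat) set))"

definition less_inning :: "'a inning \<Rightarrow> 'a inning \<Rightarrow> bool" where
  "\<alpha> < \<beta> \<longleftrightarrow> \<alpha> \<le> \<beta> \<and> \<not> \<beta> \<le> (\<alpha> :: 'a inning)"

instance
proof
  let ?r = "cardSuc (card_of (UNIV :: ('a \<times> nat) set))"
  interpret wo_rel ?r
    using inning_Well_order by (simp add: wo_rel_def)
  fix x y z :: "'a inning"
  show "(x < y) = (x \<le> y \<and> \<not> y \<le> x)" by (simp add: less_inning_def)
  show "x \<le> x" unfolding less_eq_inning_def
    using REFL Rep_inning[of x] by (auto simp: refl_on_def)
  show "x \<le> y \<Longrightarrow> y \<le> z \<Longrightarrow> x \<le> z" unfolding less_eq_inning_def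
    using TRANS by (meson transD)
  show "x \<le> y \<Longrightarrow> y \<le> x \<Longrightarrow> x = y" unfolding less_eq_inning_def
    using ANTISYM by (meson antisymD Rep_inning_inject)
  show "x \<le> y \<or> y \<le> x" unfolding less_eq_inning_def
    using TOTALS Rep_inning by blast
next
  let ?r = "cardSuc (card_of (UNIV :: ('a \<times> nat) set))"
  interpret wo_rel ?r
    using inning_Well_order by (simp add: wo_rel_def)
  fix P :: "'a inning \<Rightarrow> bool" and a
  assume *: "\<And>x. (\<And>y. y < x \<Longrightarrow> P y) \<Longrightarrow> P x"
  have "wf {(x, y). x < (y :: 'a inning)}"
  proof (rule wf_subset)
    show "wf (inv_image (?r - Id) Rep_inning)"
      using WF by (rule wf_inv_image)
    show "{(x, y). x < (y :: 'a inning)} \<subseteq> inv_image (?r - Id) Rep_inning"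
      by (auto simp: less_inning_def less_eq_inning_def inv_image_def)
  qed
  then show "P a"
    by (rule wf_induct_rule) (use * in blast)
qed

end

definition is_first :: "'i :: wellorder \<Rightarrow> bool" where
  "is_first \<alpha> \<longleftrightarrow> (\<forall>\<beta>. \<alpha> \<le> \<beta>)"

definition is_succ :: "'i :: wellorder \<Rightarrow> 'i \<Rightarrow> bool" where
  "is_succ \<beta> \<alpha> \<longleftrightarrow> \<beta> < \<alpha> \<and> \<not> (\<exists>\<gamma>. \<beta> < \<gamma> \<and> \<gamma> < \<alpha>)"

definition is_limit :: "'i :: wellorder \<Rightarrow> bool" where
  "is_limit \<alpha> \<longleftrightarrow> \<not> is_first \<alpha> \<and> \<not> (\<exists>\<beta>. is_succ \<beta> \<alpha>)"


section \<open>The game\<close>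

datatype 'a move =
    Partition (pieces: "'a set set")
  | Limit_Move (pieces: "'a set set") (point: 'a)

text \<open>\<open>legal_move X \<alpha> U m\<close>: Alice may play \<open>m\<close> in inning \<open>\<alpha>\<close>, where \<open>U \<beta>\<close> is the set that Bob
  picked in inning \<open>\<beta>\<close>, for \<open>\<beta> < \<alpha>\<close> (the other values of \<open>U\<close> are irrelevant). Every set picked by
  Bob is clopen in \<open>X\<close>, so that being clopen in \<open>U \<beta>\<close> and being clopen in \<open>X\<close> are the same thing for
  the pieces of a partition of \<open>U \<beta>\<close>.\<close>

definition legal_move ::
  "'a topology \<Rightarrow> 'a inning \<Rightarrow> ('a inning \<Rightarrow> 'a set) \<Rightarrow> 'a move \<Rightarrow> bool" where
  "legal_move X \<alpha> U m \<longleftrightarrow>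
     (is_first \<alpha> \<and>
       (\<exists>P. m = Partition P \<and> partition_on (topspace X) P \<and> (\<forall>V\<in>P. openin X V))) \<or>
     (\<exists>\<beta>. is_succ \<beta> \<alpha> \<and>
       (\<exists>P. m = Partition P \<and> partition_on (U \<beta>) P \<and> (\<forall>V\<in>P. openin X V \<and> closedin X V))) \<or>
     (is_limit \<alpha> \<and>
       (\<exists>P x. m = Limit_Move P x \<and> disjoint P \<and> {} \<notin> P \<and>
          (\<forall>V\<in>P. openin X V \<and> closedin X V) \<and> x \<in> topspace X \<and>
          (\<Inter>\<beta>\<in>{..<\<alpha>}. U \<beta>) = \<Union>P \<union> {x} \<and> x \<notin> \<Union>P))"

text \<open>\<open>play X \<alpha> M U\<close>: inning \<open>\<alpha>\<close> is reached when Alice plays \<open>M \<beta>\<close> and Bob picks \<open>U \<beta>\<close> in every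
  inning \<open>\<beta> < \<alpha>\<close>.\<close>

definition play ::
  "'a topology \<Rightarrow> 'a inning \<Rightarrow> ('a inning \<Rightarrow> 'a move) \<Rightarrow> ('a inning \<Rightarrow> 'a set) \<Rightarrow> bool" where
  "play X \<alpha> M U \<longleftrightarrow> (\<forall>\<beta><\<alpha>. legal_move X \<beta> U (M \<beta>) \<and> U \<beta> \<in> pieces (M \<beta>))"

lemma inning_no_injection: "\<not> inj (g :: 'a inning \<Rightarrow> 'a \<times> nat)"
proof
  let ?k = "card_of (UNIV :: ('a \<times> nat) set)"
  let ?F = "Field (cardSuc ?k)"
  assume g: "inj g"
  have "inj_on (g \<circ> Abs_inning) ?F"
    using g by (intro comp_inj_on inj_on_subset[OF g])
      (auto intro!: inj_onI simp: Abs_inning_inject simp del: Field_card_of)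
  then have "ordLeq3 (card_of ?F) ?k"
    by (intro card_of_ordLeq[THEN iffD1]) auto
  moreover have "ordIso2 (card_of ?F) (cardSuc ?k)"
    by (intro card_of_Field_ordIso cardSuc_Card_order card_of_Card_order)
  ultimately have "ordLeq3 (cardSuc ?k) ?k"
    using ordIso_ordLeq_trans ordIso_symmetric by blast
  then show False
    using cardSuc_greater[OF card_of_Card_order] not_ordLess_ordLeq by blast
qed

lemma inning_decompose:
  fixes \<alpha> :: "'i :: wellorder"
  shows "\<exists>\<mu> n. (is_first \<mu> \<or> is_limit \<mu>) \<and> \<alpha> = ((\<lambda>\<beta>. LEAST \<gamma>. \<beta> < \<gamma>) ^^ n) \<mu>"
proof (induction \<alpha> rule: less_induct)
  case (less \<alpha>)
  show ?case
  proof (cases "\<exists>\<beta>. is_succ \<beta> \<alpha>")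
    case True
    then obtain \<beta> where \<beta>: "is_succ \<beta> \<alpha>" by blast
    then have "(LEAST \<gamma>. \<beta> < \<gamma>) = \<alpha>"
      by (intro Least_equality) (auto simp: is_succ_def intro: leI)
    moreover obtain \<mu> n where "is_first \<mu> \<or> is_limit \<mu>"
      "\<beta> = ((\<lambda>\<beta>. LEAST \<gamma>. \<beta> < \<gamma>) ^^ n) \<mu>"
      using less[of \<beta>] \<beta> unfolding is_succ_def by blast
    ultimately show ?thesis by (intro exI[of _ \<mu>] exI[of _ "Suc n"]) auto
  next
    case False
    then show ?thesis by (intro exI[of _ \<alpha>] exI[of _ 0]) (auto simp: is_limit_def)
  qed
qed

lemma run_terminates: "\<exists>\<alpha>. \<not> play X \<alpha> M U"
proof (rule ccontr)
  assume "\<not> (\<exists>\<alpha>. \<not> play X \<alpha> M U)"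
  then have play: "\<And>\<alpha>. play X \<alpha> M U" by blast
  have ex: "\<exists>\<gamma>. \<beta> < \<gamma>" for \<beta> :: "'a inning"
  proof -
    let ?r = "cardSuc (card_of (UNIV :: ('a \<times> nat) set))"
    have "infinite (Field ?r)"
      using cardSuc_finite[OF card_of_Card_order, of "UNIV :: ('a \<times> nat) set"]
      by (simp add: Field_card_of finite_prod)
    then obtain b where "b \<in> Field ?r" "Rep_inning \<beta> \<noteq> b" "(Rep_inning \<beta>, b) \<in> ?r"
      using infinite_Card_order_limit[OF cardSuc_Card_order[OF card_of_Card_order] _
          Rep_inning, of \<beta>] by (metis FieldI2)
    then have "\<beta> \<le> Abs_inning b" "\<beta> \<noteq> Abs_inning b"
      by (auto simp: less_eq_inning_def Abs_inning_inverse)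
    then show ?thesis by (metis order_le_less)
  qed
  have legal: "legal_move X \<alpha> U (M \<alpha>)" and pick: "U \<alpha> \<in> pieces (M \<alpha>)" for \<alpha>
  proof -
    obtain \<gamma> where "\<alpha> < \<gamma>" using ex by blast
    with play[of \<gamma>] show "legal_move X \<alpha> U (M \<alpha>)" "U \<alpha> \<in> pieces (M \<alpha>)"
      by (auto simp: play_def)
  qed
  have lim: "point (M \<alpha>) \<in> U \<beta>" "point (M \<alpha>) \<notin> U \<alpha>" if "is_limit \<alpha>" "\<beta> < \<alpha>" for \<alpha> \<beta>
  proof -
    have "\<not> is_first \<alpha>" "\<nexists>\<beta>. is_succ \<beta> \<alpha>" using that by (auto simp: is_limit_def)
    with legal[of \<alpha>] have "\<exists>P x. M \<alpha> = Limit_Move P x \<and>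
      (\<Inter>\<beta>\<in>{..<\<alpha>}. U \<beta>) = \<Union>P \<union> {x} \<and> x \<notin> \<Union>P"
      unfolding legal_move_def by (elim disjE) (simp_all, metis)
    then obtain P x where Px: "M \<alpha> = Limit_Move P x"
      "(\<Inter>\<beta>\<in>{..<\<alpha>}. U \<beta>) = \<Union>P \<union> {x}" "x \<notin> \<Union>P"
      by (elim exE conjE)
    then have "x \<in> (\<Inter>\<beta>\<in>{..<\<alpha>}. U \<beta>)" by simp
    with that Px(1) show "point (M \<alpha>) \<in> U \<beta>" by simp
    show "point (M \<alpha>) \<notin> U \<alpha>" using pick[of \<alpha>] Px(1,3) by auto
  qed
  have ne: "point (M \<alpha>) \<noteq> point (M \<beta>)" if lims: "is_limit \<alpha>" "is_limit \<beta>" and lt: "\<alpha> < \<beta>" for \<alpha> \<beta>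
  proof -
    obtain \<gamma> where "\<gamma> < \<alpha>" using lims(1) by (auto simp: is_limit_def is_first_def not_le)
    with lims(1) have "point (M \<alpha>) \<notin> U \<alpha>" by (rule lim(2))
    moreover have "point (M \<beta>) \<in> U \<alpha>" using lims(2) lt by (rule lim(1))
    ultimately show ?thesis by auto
  qed
  have inj: "\<alpha> = \<beta>" if "is_limit \<alpha>" "is_limit \<beta>" "point (M \<alpha>) = point (M \<beta>)" for \<alpha> \<beta>
    using ne[of \<alpha> \<beta>] ne[of \<beta> \<alpha>] that by (cases \<alpha> \<beta> rule: linorder_cases) auto
  define s where "s = (\<lambda>\<beta> :: 'a inning. LEAST \<gamma>. \<beta> < \<gamma>)"
  have "\<forall>\<alpha>. \<exists>\<mu> n. (is_first \<mu> \<or> is_limit \<mu>) \<and> \<alpha> = (s ^^ n) \<mu>"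
    unfolding s_def using inning_decompose by auto
  then obtain L N where LN: "\<And>\<alpha>. is_first (L \<alpha>) \<or> is_limit (L \<alpha>)" "\<And>\<alpha>. \<alpha> = (s ^^ N \<alpha>) (L \<alpha>)"
    by metis
  define g where "g = (\<lambda>\<alpha>. if is_first (L \<alpha>) then (undefined :: 'a, 2 * N \<alpha>)
                else (point (M (L \<alpha>)), 2 * N \<alpha> + 1))"
  have "inj g"
  proof (rule injI)
    fix \<alpha> \<beta> assume eq: "g \<alpha> = g \<beta>"
    then have "odd (snd (g \<alpha>)) \<longleftrightarrow> odd (snd (g \<beta>))" by simp
    then have z: "is_first (L \<alpha>) \<longleftrightarrow> is_first (L \<beta>)"
      by (simp add: g_def split: if_splits)
    then have N: "N \<alpha> = N \<beta>" using eq by (simp add: g_def split: if_splits)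
    have "L \<alpha> = L \<beta>"
    proof (cases "is_first (L \<alpha>)")
      case True
      with z show ?thesis by (auto simp: is_first_def intro: order_antisym)
    next
      case False
      with z eq have "point (M (L \<alpha>)) = point (M (L \<beta>))" by (simp add: g_def)
      with False z LN(1)[of \<alpha>] LN(1)[of \<beta>] show ?thesis by (intro inj) auto
    qed
    with N LN(2)[of \<alpha>] LN(2)[of \<beta>] show "\<alpha> = \<beta>" by simp
  qed
  then show False using inning_no_injection by blast
qed

definition bob_wins_at ::
  "'a topology \<Rightarrow> 'a inning \<Rightarrow> ('a inning \<Rightarrow> 'a move) \<Rightarrow> ('a inning \<Rightarrow> 'a set) \<Rightarrow> bool" where
  "bob_wins_at X \<alpha> M U \<longleftrightarrow> play X \<alpha> M U \<and> is_limit \<alpha> \<and> \<not> (\<exists>m. legal_move X \<alpha> U m)"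

definition alice_wins_at ::
  "'a topology \<Rightarrow> 'a inning \<Rightarrow> ('a inning \<Rightarrow> 'a move) \<Rightarrow> ('a inning \<Rightarrow> 'a set) \<Rightarrow> bool" where
  "alice_wins_at X \<alpha> M U \<longleftrightarrow>
     play X \<alpha> M U \<and> is_limit \<alpha> \<and> legal_move X \<alpha> U (M \<alpha>) \<and> pieces (M \<alpha>) = {}"

definition finished_run ::
  "'a topology \<Rightarrow> 'a inning \<Rightarrow> ('a inning \<Rightarrow> 'a move) \<Rightarrow> ('a inning \<Rightarrow> 'a set) \<Rightarrow> bool" where
  "finished_run X \<alpha> M U \<longleftrightarrow> alice_wins_at X \<alpha> M U \<or> bob_wins_at X \<alpha> M U"

text \<open>A strategy sees the current inning and the sequence of Bob's previous moves only.\<close>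

type_synonym 'a strategy = "'a inning \<Rightarrow> ('a inning \<Rightarrow> 'a set) \<Rightarrow> 'a move"

definition moves_by :: "'a strategy \<Rightarrow> ('a inning \<Rightarrow> 'a set) \<Rightarrow> 'a inning \<Rightarrow> 'a move" where
  "moves_by \<sigma> U = (\<lambda>\<beta>. \<sigma> \<beta> (restrict U {..<\<beta>}))"

definition alice_strategy :: "'a topology \<Rightarrow> 'a strategy \<Rightarrow> bool" where
  "alice_strategy X \<sigma> \<longleftrightarrow>
     (\<forall>\<alpha> U. play X \<alpha> (moves_by \<sigma> U) U \<longrightarrow> (\<exists>m. legal_move X \<alpha> U m) \<longrightarrow>
        legal_move X \<alpha> U (moves_by \<sigma> U \<alpha>))"

definition winning_strategy :: "'a topology \<Rightarrow> 'a strategy \<Rightarrow> bool" where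
  "winning_strategy X \<sigma> \<longleftrightarrow>
     alice_strategy X \<sigma> \<and>
     (\<forall>\<alpha> U. finished_run X \<alpha> (moves_by \<sigma> U) U \<longrightarrow> alice_wins_at X \<alpha> (moves_by \<sigma> U) U)"

end

theory Submission
  imports Defs
begin

text \<open>If \<open>X\<close> is identified with the rays of a tree \<open>T\<close>, Alice lets Bob climb up the tree: in
  inning \<open>\<alpha>\<close> her pieces are the sets of rays through a common node of height \<open>\<alpha>\<close>, and her point in
  a limit inning is the ray that consists of exactly the nodes that Bob has visited. Conversely, a
  winning strategy makes every point \<open>x\<close> of \<open>X\<close> play a run, in which Bob always picks the piece
  containing \<open>x\<close>; this run can only end in a limit inning in which Alice plays the point \<open>x\<close>. The
  histories of the play before the non-limit innings form a tree, whose rays are exactly the runs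
  of the points.\<close>

section \<open>Innings and plays\<close>

text \<open>The game sees the topology of \<open>X\<close> only through the clopen sets that are
  played, which is why quasi-ray spaces appear. The sets of rays through a node stay clopen in every
  finer topology. Conversely, the map \<open>trail\<close> from points to rays is a continuous
  bijection that need not be open, so the ray topology is pulled back along it and gives a topology
  contained in that of \<open>X\<close>. The limit innings carry the weight. A ray has no maximal
  element, so it can end only there, and just there Alice gives up one point. For a given tree she
  has such a point because every ray belongs to a point of \<open>X\<close>; for a given winning
  strategy, her having a move there is what makes every ray of the history tree come from a
  point.\<close>

lemma is_succ_exists:
  assumes "\<beta> < \<alpha>"
  shows "\<exists>\<gamma>. is_succ \<beta> \<gamma> \<and> \<gamma> \<le> \<alpha>"
proof -
  let ?\<gamma> = "LEAST \<gamma>. \<beta> < \<gamma>"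
  have "\<beta> < ?\<gamma>" "?\<gamma> \<le> \<alpha>" using assms by (auto intro: LeastI Least_le)
  moreover have "\<not> (\<exists>\<delta>. \<beta> < \<delta> \<and> \<delta> < ?\<gamma>)" using not_less_Least by blast
  ultimately show ?thesis by (auto simp: is_succ_def)
qed

lemma is_succ_less_iff: "is_succ \<beta> \<alpha> \<Longrightarrow> \<gamma> < \<alpha> \<longleftrightarrow> \<gamma> \<le> \<beta>"
  unfolding is_succ_def by (meson le_less_trans not_le)

lemma is_succ_unique: "\<lbrakk>is_succ \<beta> \<alpha>; is_succ \<gamma> \<alpha>\<rbrakk> \<Longrightarrow> \<beta> = \<gamma>"
  unfolding is_succ_def by (meson linorder_neqE)

lemma is_limit_succ:
  assumes "is_limit \<alpha>" "\<beta> < \<alpha>"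
  shows "\<exists>\<gamma><\<alpha>. is_succ \<beta> \<gamma>"
  using is_succ_exists[OF assms(2)] assms(1) unfolding is_limit_def by (metis le_less)

lemma inning_cases:
  obtains "is_first \<alpha>" | \<beta> where "is_succ \<beta> \<alpha>" | "is_limit \<alpha>"
  by (auto simp: is_limit_def)

lemma is_first_not_less: "is_first \<alpha> \<Longrightarrow> \<not> \<beta> < \<alpha>"
  by (auto simp: is_first_def not_less)

lemma is_first_not_succ: "is_first \<alpha> \<Longrightarrow> \<not> is_succ \<beta> \<alpha>"
  by (auto simp: is_succ_def is_first_not_less)

lemma is_limitD: "is_limit \<alpha> \<Longrightarrow> \<not> is_first \<alpha>" "is_limit \<alpha> \<Longrightarrow> \<not> is_succ \<beta> \<alpha>"
  by (auto simp: is_limit_def)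

lemma is_limit_nonempty:
  assumes "is_limit \<alpha>"
  shows "\<exists>\<beta>. \<beta> < \<alpha>"
  using assms by (auto simp: is_limit_def is_first_def not_le)

section \<open>Legal moves by type of inning, and their dependence on earlier picks only\<close>

lemma legal_move_first:
  "is_first \<alpha> \<Longrightarrow> legal_move X \<alpha> U m \<longleftrightarrow>
     (\<exists>P. m = Partition P \<and> partition_on (topspace X) P \<and> (\<forall>V\<in>P. openin X V))"
  by (auto simp: legal_move_def is_first_not_succ dest: is_limitD(1))

lemma legal_move_succ:
  assumes "is_succ \<beta> \<alpha>"
  shows "legal_move X \<alpha> U m \<longleftrightarrow>
     (\<exists>P. m = Partition P \<and> partition_on (U \<beta>) P \<and> (\<forall>V\<in>P. openin X V \<and> closedin X V))"
proof -
  have "\<not> is_first \<alpha>" "\<not> is_limit \<alpha>" "\<And>\<gamma>. is_succ \<gamma> \<alpha> \<longleftrightarrow> \<gamma> = \<beta>"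
    using assms is_first_not_succ is_limitD is_succ_unique by blast+
  then show ?thesis unfolding legal_move_def by simp
qed

lemma legal_move_limit:
  "is_limit \<alpha> \<Longrightarrow> legal_move X \<alpha> U m \<longleftrightarrow>
     (\<exists>P x. m = Limit_Move P x \<and> disjoint P \<and> {} \<notin> P \<and>
          (\<forall>V\<in>P. openin X V \<and> closedin X V) \<and> x \<in> topspace X \<and>
          (\<Inter>\<beta>\<in>{..<\<alpha>}. U \<beta>) = \<Union>P \<union> {x} \<and> x \<notin> \<Union>P)"
  by (simp add: legal_move_def is_limitD)

text \<open>Bob's picks are coded as a function on all innings, whose values from \<alpha> on are
  arbitrary. This lemma and the next two transfer a position between functions that agree below
  \<alpha>.\<close>

lemma legal_move_cong:
  assumes "\<And>\<beta>. \<beta> < \<alpha> \<Longrightarrow> U \<beta> = V \<beta>"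
  shows "legal_move X \<alpha> U m \<longleftrightarrow> legal_move X \<alpha> V m"
proof -
  have "U \<beta> = V \<beta>" if "is_succ \<beta> \<alpha>" for \<beta> using assms that by (simp add: is_succ_def)
  then have "(\<exists>\<beta>. is_succ \<beta> \<alpha> \<and>
        (\<exists>P. m = Partition P \<and> partition_on (U \<beta>) P \<and> (\<forall>V\<in>P. openin X V \<and> closedin X V))) \<longleftrightarrow>
      (\<exists>\<beta>. is_succ \<beta> \<alpha> \<and>
        (\<exists>P. m = Partition P \<and> partition_on (V \<beta>) P \<and> (\<forall>V\<in>P. openin X V \<and> closedin X V)))"
    by (metis (no_types, lifting))
  moreover have "(\<Inter>\<beta>\<in>{..<\<alpha>}. U \<beta>) = (\<Inter>\<beta>\<in>{..<\<alpha>}. V \<beta>)" using assms by auto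
  ultimately show ?thesis unfolding legal_move_def by (simp only:)
qed

lemma moves_by_cong:
  assumes "\<And>\<gamma>. \<gamma> < \<beta> \<Longrightarrow> U \<gamma> = V \<gamma>"
  shows "moves_by \<sigma> U \<beta> = moves_by \<sigma> V \<beta>"
proof -
  have "restrict U {..<\<beta>} = restrict V {..<\<beta>}" using assms by (intro restrict_ext) auto
  then show ?thesis by (simp add: moves_by_def)
qed

lemma play_moves_by_cong:
  assumes "\<And>\<beta>. \<beta> < \<alpha> \<Longrightarrow> U \<beta> = V \<beta>"
  shows "play X \<alpha> (moves_by \<sigma> U) U \<longleftrightarrow> play X \<alpha> (moves_by \<sigma> V) V"
proof -
  have "moves_by \<sigma> U \<beta> = moves_by \<sigma> V \<beta>" if "\<beta> < \<alpha>" for \<beta>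
    using that assms by (intro moves_by_cong) simp
  moreover have "legal_move X \<beta> U m \<longleftrightarrow> legal_move X \<beta> V m" if "\<beta> < \<alpha>" for \<beta> m
    using that assms by (intro legal_move_cong) simp
  ultimately show ?thesis using assms by (auto simp: play_def)
qed

lemma play_mono: "\<lbrakk>play X \<alpha> M U; \<beta> \<le> \<alpha>\<rbrakk> \<Longrightarrow> play X \<beta> M U"
  by (auto simp: play_def)

section \<open>Bob's sets are clopen, non-empty and decreasing\<close>

lemma legal_move_pieces:
  assumes "legal_move X \<alpha> U m"
  shows "disjoint (pieces m)" "{} \<notin> pieces m"
    "\<And>V. V \<in> pieces m \<Longrightarrow> openin X V \<and> closedin X V"
    "\<And>V \<beta>. \<lbrakk>V \<in> pieces m; is_succ \<beta> \<alpha>\<rbrakk> \<Longrightarrow> V \<subseteq> U \<beta>"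
    "\<And>V \<beta>. \<lbrakk>V \<in> pieces m; is_limit \<alpha>; \<beta> < \<alpha>\<rbrakk> \<Longrightarrow> V \<subseteq> U \<beta>"
proof -
  show "disjoint (pieces m)" "{} \<notin> pieces m"
    using assms by (auto simp: legal_move_def partition_on_def)
  show "openin X V \<and> closedin X V" if V: "V \<in> pieces m" for V
  proof (cases "is_first \<alpha>")
    case True
    then have P: "partition_on (topspace X) (pieces m)" "\<forall>W\<in>pieces m. openin X W"
      using assms by (auto simp: legal_move_first)
    \<comment> \<open>In inning 0 Alice is only asked for open pieces; they are closed as well
      because the complement of a piece is the union of the others.\<close>
    have "topspace X - V = \<Union>(pieces m - {V})"
      using P(1) V by (auto simp: partition_on_def pairwise_def disjnt_def)
    moreover have "openin X (\<Union>(pieces m - {V}))" using P(2) by auto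
    ultimately show ?thesis using P V openin_closedin_eq by (metis closedin_def openin_subset)
  next
    case False
    then show ?thesis using assms V by (auto simp: legal_move_def)
  qed
  show "V \<subseteq> U \<beta>" if "V \<in> pieces m" "is_succ \<beta> \<alpha>" for V \<beta>
    using assms that by (auto simp: legal_move_succ partition_on_def)
  show "V \<subseteq> U \<beta>" if V: "V \<in> pieces m" "is_limit \<alpha>" "\<beta> < \<alpha>" for V \<beta>
  proof -
    have "V \<subseteq> (\<Inter>\<beta>\<in>{..<\<alpha>}. U \<beta>)" using assms V by (auto simp: legal_move_limit)
    then show ?thesis using V by auto
  qed
qed

lemma play_antimono:
  assumes "play X \<alpha> M U" "\<gamma> \<le> \<beta>" "\<beta> < \<alpha>"
  shows "U \<beta> \<subseteq> U \<gamma>"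
  using assms(2,3)
proof (induction \<beta> rule: less_induct)
  case (less \<beta>)
  have l: "legal_move X \<beta> U (M \<beta>)" "U \<beta> \<in> pieces (M \<beta>)"
    using assms(1) less.prems by (auto simp: play_def)
  show ?case
  proof (cases "\<gamma> = \<beta>")
    case False
    then have lt: "\<gamma> < \<beta>" using less.prems by simp
    show ?thesis
    proof (cases \<beta> rule: inning_cases)
      case 1
      then show ?thesis using lt is_first_not_less by blast
    next
      case (2 \<delta>)
      then have "\<gamma> \<le> \<delta>" "\<delta> < \<beta>" using lt is_succ_less_iff is_succ_def by blast+
      then have "U \<delta> \<subseteq> U \<gamma>" using less by simp
      then show ?thesis using legal_move_pieces(4)[OF l 2] by blast
    next
      case 3
      show ?thesis by (rule legal_move_pieces(5)[OF l 3 lt])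
    qed
  qed simp
qed

lemma play_clopen:
  assumes "play X \<alpha> M U" "\<beta> < \<alpha>"
  shows "openin X (U \<beta>)" "closedin X (U \<beta>)" "U \<beta> \<noteq> {}" "U \<beta> \<subseteq> topspace X"
proof -
  have l: "legal_move X \<beta> U (M \<beta>)" "U \<beta> \<in> pieces (M \<beta>)"
    using assms by (auto simp: play_def)
  show "openin X (U \<beta>)" "closedin X (U \<beta>)" "U \<beta> \<noteq> {}"
    using legal_move_pieces[OF l(1)] l(2) by auto
  then show "U \<beta> \<subseteq> topspace X" by (simp add: openin_subset)
qed


section \<open>Nodes of a given height in a ray\<close>

text \<open>Below any \<open>v\<close> in \<open>A\<close> the tree is well-founded, which yields a
  minimal element of \<open>A\<close>; since a ray is a chain, minimal means least.\<close>

lemma ray_least: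
  assumes tree: "is_tree T r" and R: "is_ray T r R" and A: "A \<subseteq> R" "A \<noteq> {}"
  shows "\<exists>t\<in>A. \<forall>s\<in>A. (t, s) \<in> r"
proof -
  from A obtain v where v: "v \<in> A" by auto
  let ?B = "{s\<in>T. (s, v) \<in> r}"
  have RT: "R \<subseteq> T" using R by (simp add: is_ray_def)
  have refl: "\<And>t. t \<in> T \<Longrightarrow> (t, t) \<in> r" and tr: "trans r"
    using tree by (auto simp: is_tree_def order_on_defs refl_on_def)
  have vT: "v \<in> T" using v A RT by auto
  have "wf (Restr r ?B - Id)"
    using tree vT by (auto simp: is_tree_def well_order_on_def)
  moreover have "v \<in> A \<inter> ?B" using v vT refl by auto
  ultimately obtain t where t: "t \<in> A \<inter> ?B"
    and mn: "\<And>y. (y, t) \<in> Restr r ?B - Id \<Longrightarrow> y \<notin> A \<inter> ?B"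
    by (rule wfE_min) blast
  have "(t, s) \<in> r" if s: "s \<in> A" for s
  proof (rule ccontr)
    assume n: "(t, s) \<notin> r"
    then have "s \<noteq> t" "(s, t) \<in> r"
      using s t A R refl RT unfolding is_ray_def by blast+
    moreover have "(s, v) \<in> r" using \<open>(s, t) \<in> r\<close> t tr by (blast dest: transD)
    moreover have "s \<in> T" using s A RT by auto
    ultimately show False using mn[of s] s t by blast
  qed
  with t show ?thesis by blast
qed

text \<open>The increasing transfinite enumeration of \<open>R\<close>: its least element not yet
  listed, hence the node of height \<alpha>. Once \<open>R\<close> is exhausted the value is
  arbitrary.\<close>

function node :: "'b rel \<Rightarrow> 'b set \<Rightarrow> 'i :: wellorder \<Rightarrow> 'b" where
  "node r R \<alpha> = (SOME t. t \<in> R - node r R ` {..<\<alpha>} \<and> (\<forall>s \<in> R - node r R ` {..<\<alpha>}. (t, s) \<in> r))"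
  by auto
termination
  by (relation "inv_image {(x, y). x < y} (\<lambda>(r, R, \<alpha>). \<alpha>)")
    (rule wf_inv_image, rule wf, auto simp: inv_image_def)

declare node.simps [simp del]

text \<open>Says that the order type of \<open>R\<close> exceeds \<alpha>. It is phrased by
  inclusion rather than equality because past the end of \<open>R\<close> the image contains
  arbitrary values of \<open>node\<close>.\<close>

definition longer :: "'b rel \<Rightarrow> 'b set \<Rightarrow> 'i :: wellorder \<Rightarrow> bool" where
  "longer r R \<alpha> \<longleftrightarrow> \<not> R \<subseteq> node r R ` {..<\<alpha>}"

lemma longer_mono: "\<lbrakk>longer r R \<alpha>; \<beta> \<le> \<alpha>\<rbrakk> \<Longrightarrow> longer r R \<beta>"
  unfolding longer_def by fastforce

context
  fixes T :: "'b set" and r R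
  assumes tree: "is_tree T r" and R: "is_ray T r R"
begin

lemma node_least:
  assumes "longer r R \<alpha>"
  shows "node r R \<alpha> \<in> R" "node r R \<alpha> \<notin> node r R ` {..<\<alpha>}"
    "\<And>s. \<lbrakk>s \<in> R; s \<notin> node r R ` {..<\<alpha>}\<rbrakk> \<Longrightarrow> (node r R \<alpha>, s) \<in> r"
proof -
  have "R - node r R ` {..<\<alpha>} \<noteq> {}" using assms by (auto simp: longer_def)
  then have "\<exists>t. t \<in> R - node r R ` {..<\<alpha>} \<and> (\<forall>s \<in> R - node r R ` {..<\<alpha>}. (t, s) \<in> r)"
    using ray_least[OF tree R, of "R - node r R ` {..<\<alpha>}"] by blast
  from someI_ex[OF this] show "node r R \<alpha> \<in> R" "node r R \<alpha> \<notin> node r R ` {..<\<alpha>}"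
    "\<And>s. \<lbrakk>s \<in> R; s \<notin> node r R ` {..<\<alpha>}\<rbrakk> \<Longrightarrow> (node r R \<alpha>, s) \<in> r"
    unfolding node.simps[of r R \<alpha>, symmetric] by auto
qed

lemma node_less:
  assumes "longer r R \<alpha>" "\<gamma> < \<alpha>"
  shows "(node r R \<gamma>, node r R \<alpha>) \<in> r" "node r R \<gamma> \<noteq> node r R \<alpha>"
proof -
  have "longer r R \<gamma>" using longer_mono assms by fastforce
  moreover have "node r R \<alpha> \<notin> node r R ` {..<\<gamma>}" using node_least(2)[OF assms(1)] assms(2) by auto
  ultimately show "(node r R \<gamma>, node r R \<alpha>) \<in> r" using node_least[OF assms(1)] node_least(3) by blast
  show "node r R \<gamma> \<noteq> node r R \<alpha>"
    using node_least(2)[OF assms(1)] assms(2) by (metis imageI lessThan_iff)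
qed

lemma node_predecessors:
  assumes "longer r R \<alpha>" "(s, node r R \<alpha>) \<in> r"
  shows "s \<in> node r R ` {..\<alpha>}"
proof (rule ccontr)
  assume n: "s \<notin> node r R ` {..\<alpha>}"
  have "r \<subseteq> T \<times> T" and as: "antisym r" using tree by (auto simp: is_tree_def order_on_defs)
  then have "s \<in> R" using assms node_least(1)[OF assms(1)] R unfolding is_ray_def by blast
  moreover have "s \<notin> node r R ` {..<\<alpha>}" using n by auto
  ultimately have "(node r R \<alpha>, s) \<in> r" using node_least(3)[OF assms(1)] by blast
  with assms(2) as have "s = node r R \<alpha>" by (metis antisymD)
  with n show False by auto
qed

text \<open>Height belongs to the node, not to the ray through it: by downward closure two rays that
  share a node share all nodes below it. Inductively, \<open>node r R' \<alpha>\<close> lies below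
  \<open>node r R \<alpha>\<close>, hence has some height \<le> \<alpha> in \<open>R\<close>, and
  the smaller heights are taken.\<close>

lemma node_of_other_ray:
  assumes R': "is_ray T r R'" and "longer r R \<alpha>" "node r R \<alpha> \<in> R'"
  shows "longer r R' \<alpha> \<and> node r R' \<alpha> = node r R \<alpha>"
  using assms(2,3)
proof (induction \<alpha> rule: less_induct)
  case (less \<alpha>)
  have rT: "r \<subseteq> T \<times> T" and as: "antisym r" using tree by (auto simp: is_tree_def order_on_defs)
  have "node r R' \<gamma> = node r R \<gamma>" if g: "\<gamma> < \<alpha>" for \<gamma>
  proof -
    have "longer r R \<gamma>" using longer_mono less.prems g by fastforce
    moreover have "node r R \<gamma> \<in> R'"
      using node_less(1)[OF less.prems(1) g] less.prems(2) R' rT unfolding is_ray_def by blast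
    ultimately show ?thesis using less.IH g by blast
  qed
  then have eq: "node r R' ` {..<\<alpha>} = node r R ` {..<\<alpha>}" by (intro image_cong) auto
  have out: "node r R \<alpha> \<notin> node r R' ` {..<\<alpha>}" using node_least(2)[OF less.prems(1)] eq by simp
  then have long: "longer r R' \<alpha>" using less.prems(2) by (auto simp: longer_def)
  note l = Submission.node_least[OF tree R' long]
  have "(node r R' \<alpha>, node r R \<alpha>) \<in> r" using l(3) out less.prems(2) by blast
  then have "node r R' \<alpha> \<in> node r R ` {..\<alpha>}" by (rule node_predecessors[OF less.prems(1)])
  moreover have "node r R' \<alpha> \<notin> node r R ` {..<\<alpha>}" using l(2) eq by simp
  ultimately have "node r R' \<alpha> = node r R \<alpha>" by (auto simp: le_less)
  with long show ?case by blast
qed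

lemma longer_first: "is_first \<alpha> \<Longrightarrow> longer r R \<alpha>"
  using R is_first_not_less by (fastforce simp: longer_def is_ray_def)

text \<open>A ray has no maximal element, so it cannot stop right after height \<beta>. Hence in a
  successor inning the pieces of \<open>climb\<close> cover all of Bob's set.\<close>

lemma longer_succ:
  assumes "longer r R \<beta>" "is_succ \<beta> \<alpha>"
  shows "longer r R \<alpha>"
proof -
  obtain u where u: "u \<in> R" "(node r R \<beta>, u) \<in> r" "u \<noteq> node r R \<beta>"
    using R node_least(1)[OF assms(1)] unfolding is_ray_def by blast
  have as: "antisym r" using tree by (auto simp: is_tree_def order_on_defs)
  have "u \<notin> node r R ` {..<\<alpha>}"
  proof
    assume "u \<in> node r R ` {..<\<alpha>}"
    then obtain \<gamma> where "\<gamma> \<le> \<beta>" "u = node r R \<gamma>" using is_succ_less_iff[OF assms(2)] by auto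
    with u have "(u, node r R \<beta>) \<in> r"
      using node_less(1)[OF assms(1)] by (metis le_less)
    with u as show False by (metis antisymD)
  qed
  with u show ?thesis by (auto simp: longer_def)
qed

end


section \<open>The strategy of climbing a tree\<close>

text \<open>\<open>I\<close> is the set of points still in play. The pieces are not intersected with
  \<open>I\<close>: rays that share a node of height \<alpha> share the earlier ones too, so the
  pieces lie in \<open>I\<close> anyway, and they are clopen as they stand.\<close>

definition climb :: "'a topology \<Rightarrow> 'b rel \<Rightarrow> ('a \<Rightarrow> 'b set) \<Rightarrow> 'a strategy" where
  "climb X r f = (\<lambda>\<alpha> U.
     let I = {x \<in> topspace X. \<forall>\<beta><\<alpha>. x \<in> U \<beta>};
         P = (\<lambda>x. {y \<in> topspace X. node r (f x) \<alpha> \<in> f y}) ` {x \<in> I. longer r (f x) \<alpha>}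
     in if is_limit \<alpha> then Limit_Move P (THE x. x \<in> I \<and> \<not> longer r (f x) \<alpha>) else Partition P)"

context
  fixes X :: "'a topology" and T :: "'b set" and r and f :: "'a \<Rightarrow> 'b set"
  assumes tree: "is_tree T r"
    and f: "bij_betw f (topspace X) {R. is_ray T r R}"
    and clopen: "\<And>t. t \<in> T \<Longrightarrow>
      openin X {x \<in> topspace X. t \<in> f x} \<and> closedin X {x \<in> topspace X. t \<in> f x}"
begin

abbreviation through :: "'a inning \<Rightarrow> 'a \<Rightarrow> 'a set" where
  "through \<alpha> x \<equiv> {y \<in> topspace X. node r (f x) \<alpha> \<in> f y}"

lemma ray_f: "x \<in> topspace X \<Longrightarrow> is_ray T r (f x)"
  using f by (auto simp: bij_betw_def)

lemma node_eq_throughD: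
  assumes "x \<in> topspace X" "longer r (f x) \<alpha>" "y \<in> through \<alpha> x" "\<gamma> \<le> \<alpha>"
  shows "longer r (f y) \<gamma>" "node r (f y) \<gamma> = node r (f x) \<gamma>"
proof -
  have y: "y \<in> topspace X" "node r (f x) \<alpha> \<in> f y" using assms(3) by auto
  have xg: "longer r (f x) \<gamma>" using longer_mono assms by blast
  have rT: "r \<subseteq> T \<times> T" using tree by (auto simp: is_tree_def order_on_defs)
  have "node r (f x) \<gamma> \<in> f y"
  proof (cases "\<gamma> = \<alpha>")
    case False
    then have "(node r (f x) \<gamma>, node r (f x) \<alpha>) \<in> r"
      using node_less(1)[OF tree ray_f[OF assms(1)] assms(2)] assms(4) by simp
    then show ?thesis using y ray_f[OF y(1)] rT unfolding is_ray_def by blast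
  qed (use y in simp)
  then have "longer r (f y) \<gamma> \<and> node r (f y) \<gamma> = node r (f x) \<gamma>"
    by (rule node_of_other_ray[OF tree ray_f[OF assms(1)] ray_f[OF y(1)] xg])
  then show "longer r (f y) \<gamma>" "node r (f y) \<gamma> = node r (f x) \<gamma>" by auto
qed

text \<open>By the form of Alice's pieces, each set picked by Bob consists of all points through one
  node. In non-limit innings every ray in play has a node of height \<alpha>, so the pieces cover;
  in limit innings exactly one ray in play has none, and it is her point.\<close>

lemma climb_legal:
  assumes play: "play X \<alpha> (moves_by (climb X r f) U) U"
  shows "legal_move X \<alpha> U (moves_by (climb X r f) U \<alpha>)"
proof -
  have inv: "\<exists>x. x \<in> topspace X \<and> longer r (f x) \<beta> \<and> U \<beta> = through \<beta> x" if "\<beta> < \<alpha>" for \<beta>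
  proof -
    have "U \<beta> \<in> pieces (moves_by (climb X r f) U \<beta>)"
      using play that by (auto simp: play_def)
    then show ?thesis by (auto simp: moves_by_def climb_def Let_def split: if_splits)
  qed
  define I where "I = {x \<in> topspace X. \<forall>\<beta><\<alpha>. x \<in> U \<beta>}"
  define J where "J = {x \<in> I. longer r (f x) \<alpha>}"
  define P where "P = through \<alpha> ` J"
  have move: "moves_by (climb X r f) U \<alpha> =
    (if is_limit \<alpha> then Limit_Move P (THE x. x \<in> I \<and> \<not> longer r (f x) \<alpha>) else Partition P)"
  proof -
    have "{x \<in> topspace X. \<forall>\<beta><\<alpha>. x \<in> restrict U {..<\<alpha>} \<beta>} = I" by (auto simp: I_def)
    then show ?thesis unfolding moves_by_def climb_def Let_def P_def J_def by simp
  qed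
  have JD: "x \<in> topspace X" "longer r (f x) \<alpha>" "x \<in> I" if "x \<in> J" for x
    using that by (auto simp: J_def I_def)
  have self: "x \<in> through \<beta> x" if "x \<in> topspace X" "longer r (f x) \<beta>" for x \<beta>
    using that node_least(1)[OF tree ray_f] by auto
  have throughJ: "through \<alpha> x \<subseteq> J" if x: "x \<in> J" for x
  proof
    fix y assume y: "y \<in> through \<alpha> x"
    note e = node_eq_throughD[OF JD(1,2)[OF x] y]
    have "y \<in> U \<beta>" if b: "\<beta> < \<alpha>" for \<beta>
    proof -
      obtain z where z: "z \<in> topspace X" "longer r (f z) \<beta>" "U \<beta> = through \<beta> z"
        using inv[OF b] by blast
      have "x \<in> through \<beta> z" using JD(3)[OF x] b z by (auto simp: I_def)
      then have "node r (f x) \<beta> = node r (f z) \<beta>" using node_eq_throughD(2)[OF z(1,2)] by blast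
      moreover have "node r (f y) \<beta> = node r (f x) \<beta>" "longer r (f y) \<beta>" using e b by auto
      ultimately show ?thesis using z self[of y \<beta>] y by simp
    qed
    then show "y \<in> J" using y e(1) by (auto simp: J_def I_def)
  qed
  have UP: "\<Union>P = J" using throughJ self JD by (fastforce simp: P_def)
  have ne: "{} \<notin> P" using self JD by (fastforce simp: P_def)
  have disj: "disjoint P"
  proof (rule disjointI)
    fix A B assume AB: "A \<in> P" "B \<in> P" "A \<noteq> B"
    then obtain x y where xy: "x \<in> J" "y \<in> J" "A = through \<alpha> x" "B = through \<alpha> y"
      by (auto simp: P_def)
    show "A \<inter> B = {}"
    proof (rule ccontr)
      assume "A \<inter> B \<noteq> {}"
      then obtain z where z: "z \<in> through \<alpha> x" "z \<in> through \<alpha> y" unfolding xy by blast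
      then have "node r (f x) \<alpha> = node r (f y) \<alpha>"
        using node_eq_throughD(2)[OF JD(1,2)[OF xy(1)] z(1)]
          node_eq_throughD(2)[OF JD(1,2)[OF xy(2)] z(2)] by auto
      with xy AB show False by simp
    qed
  qed
  have part: "partition_on J P" using UP ne disj by (auto simp: partition_on_def)
  have cl: "openin X V \<and> closedin X V" if V: "V \<in> P" for V
  proof -
    from V obtain x where x: "x \<in> J" "V = through \<alpha> x" by (auto simp: P_def)
    have "node r (f x) \<alpha> \<in> T"
      using node_least(1)[OF tree ray_f JD(2), OF JD(1)] ray_f JD(1) x(1)
      unfolding is_ray_def by blast
    from clopen[OF this] show ?thesis by (simp add: x)
  qed
  show ?thesis
  proof (cases \<alpha> rule: inning_cases)
    case 1
    then have "J = topspace X"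
      using longer_first[OF tree ray_f] is_first_not_less by (auto simp: J_def I_def)
    then show ?thesis using 1 part cl is_limitD by (auto simp: legal_move_first move)
  next
    case (2 \<beta>)
    then have b: "\<beta> < \<alpha>" by (simp add: is_succ_def)
    obtain z where z: "z \<in> topspace X" "longer r (f z) \<beta>" "U \<beta> = through \<beta> z"
      using inv[OF b] by blast
    have "J = U \<beta>"
    proof
      show "J \<subseteq> U \<beta>" using b by (auto simp: J_def I_def)
      show "U \<beta> \<subseteq> J"
      proof
        fix y assume y: "y \<in> U \<beta>"
        have yX: "y \<in> topspace X" using y z by simp
        have "\<forall>\<gamma><\<alpha>. y \<in> U \<gamma>"
          using y play_antimono[OF play _ b] is_succ_less_iff[OF 2] by blast
        moreover have "longer r (f y) \<beta>"
          using node_eq_throughD(1)[OF z(1,2), of y \<beta>] y z(3) by simp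
        then have "longer r (f y) \<alpha>" using longer_succ[OF tree ray_f[OF yX]] 2 by blast
        ultimately show "y \<in> J" using yX by (simp add: J_def I_def)
      qed
    qed
    then show ?thesis using 2 part cl is_limitD by (auto simp: legal_move_succ move)
  next
    case 3
    obtain z where z: "\<And>\<beta>. \<beta> < \<alpha> \<Longrightarrow> z \<beta> \<in> topspace X"
      "\<And>\<beta>. \<beta> < \<alpha> \<Longrightarrow> longer r (f (z \<beta>)) \<beta>" "\<And>\<beta>. \<beta> < \<alpha> \<Longrightarrow> U \<beta> = through \<beta> (z \<beta>)"
      using inv by metis
    define c where "c = (\<lambda>\<beta>. node r (f (z \<beta>)) \<beta>)"
    \<comment> \<open>The witnesses \<open>z \<beta>\<close> may all be different, but Bob's sets
      decrease, so \<open>z \<beta>\<close> lies in the earlier sets too and its ray passes through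
      the nodes chosen there.\<close>
    have zc: "node r (f (z \<beta>)) \<gamma> = c \<gamma>" if "\<gamma> \<le> \<beta>" "\<beta> < \<alpha>" for \<beta> \<gamma>
    proof -
      have "z \<beta> \<in> U \<beta>" using that self z by simp
      then have "z \<beta> \<in> U \<gamma>" using play_antimono[OF play that] by blast
      then have "z \<beta> \<in> through \<gamma> (z \<gamma>)" using z(3)[of \<gamma>] that by auto
      then show ?thesis
        using node_eq_throughD(2)[of "z \<gamma>" \<gamma> "z \<beta>" \<gamma>] z(1,2)[of \<gamma>] that by (simp add: c_def)
    qed
    have cR: "c \<gamma> \<in> f (z \<beta>)" if "\<gamma> \<le> \<beta>" "\<beta> < \<alpha>" for \<beta> \<gamma>
      using node_least(1)[OF tree ray_f[OF z(1)], of \<beta> \<gamma>] longer_mono[OF z(2)] zc that by metis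
    have cless: "(c \<gamma>, c \<beta>) \<in> r \<and> c \<gamma> \<noteq> c \<beta>" if "\<gamma> < \<beta>" "\<beta> < \<alpha>" for \<beta> \<gamma>
      using node_less[OF tree ray_f[OF z(1)] z(2), of \<beta> \<gamma>] that zc[of \<gamma> \<beta>] zc[of \<beta> \<beta>] by auto
    have cT: "c \<beta> \<in> T" if "\<beta> < \<alpha>" for \<beta>
      using cR[of \<beta> \<beta>] that ray_f[OF z(1)[OF that]] by (auto simp: is_ray_def)
    have refl: "\<And>t. t \<in> T \<Longrightarrow> (t, t) \<in> r"
      using tree by (auto simp: is_tree_def order_on_defs refl_on_def)
    define C where "C = c ` {..<\<alpha>}"
    have "is_ray T r C"
      unfolding is_ray_def
    proof (intro conjI ballI impI)
      show "C \<subseteq> T" using cT by (auto simp: C_def)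
      show "C \<noteq> {}" using is_limit_nonempty[OF 3] by (auto simp: C_def)
    next
      fix t s assume t: "t \<in> C" and s: "(s, t) \<in> r"
      then obtain \<beta> where b: "\<beta> < \<alpha>" "t = c \<beta>" by (auto simp: C_def)
      then have "s \<in> node r (f (z \<beta>)) ` {..\<beta>}"
        using node_predecessors[OF tree ray_f[OF z(1)] z(2), of \<beta> s] s zc[of \<beta> \<beta>] by auto
      then show "s \<in> C" using zc b by (auto simp: C_def)
    next
      fix s t assume "s \<in> C" "t \<in> C"
      then obtain \<gamma> \<beta> where b: "\<gamma> < \<alpha>" "s = c \<gamma>" "\<beta> < \<alpha>" "t = c \<beta>" by (auto simp: C_def)
      show "(s, t) \<in> r \<or> (t, s) \<in> r"
        using b cless[of \<gamma> \<beta>] cless[of \<beta> \<gamma>] refl cT by (cases \<gamma> \<beta> rule: linorder_cases) auto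
    next
      show "\<not> (\<exists>m\<in>C. \<forall>t\<in>C. (m, t) \<in> r \<longrightarrow> t = m)"
      proof
        assume "\<exists>m\<in>C. \<forall>t\<in>C. (m, t) \<in> r \<longrightarrow> t = m"
        then obtain \<beta> where b: "\<beta> < \<alpha>" "\<And>\<gamma>. \<gamma> < \<alpha> \<Longrightarrow> (c \<beta>, c \<gamma>) \<in> r \<Longrightarrow> c \<gamma> = c \<beta>"
          by (auto simp: C_def)
        obtain \<gamma> where "\<gamma> < \<alpha>" "\<beta> < \<gamma>" using is_limit_succ[OF 3 b(1)] by (auto simp: is_succ_def)
        then show False using cless[of \<beta> \<gamma>] b(2)[of \<gamma>] by auto
      qed
    qed
    \<comment> \<open>\<open>C\<close> has no maximal element because \<alpha> is a limit.
      Surjectivity of \<open>f\<close> now supplies Alice's point and so keeps Bob from winning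
      here.\<close>
    then have "C \<in> f ` topspace X" using f by (simp add: bij_betw_def)
    then obtain p where p: "p \<in> topspace X" "f p = C" by auto
    have nodeI: "node r (f y) \<beta> = c \<beta>" if "y \<in> I" "\<beta> < \<alpha>" for y \<beta>
    proof -
      have "y \<in> U \<beta>" using that by (simp add: I_def)
      then have "y \<in> through \<beta> (z \<beta>)" by (simp only: z(3)[OF that(2)])
      then show ?thesis
        using node_eq_throughD(2)[OF z(1,2)[OF that(2)], of y \<beta>] by (simp add: c_def)
    qed
    have "p \<in> U \<beta>" if "\<beta> < \<alpha>" for \<beta>
    proof -
      have "c \<beta> \<in> f p" using p that by (auto simp: C_def)
      then show ?thesis using p(1) by (simp add: z(3)[OF that] c_def)
    qed
    then have pI: "p \<in> I" using p by (simp add: I_def)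
    have imC: "node r (f y) ` {..<\<alpha>} = C" if "y \<in> I" for y
      using nodeI[OF that] by (auto simp: C_def)
    have plong: "\<not> longer r (f p) \<alpha>" using imC[OF pI] p by (simp add: longer_def)
    \<comment> \<open>The ray of a point in play contains \<open>C\<close>; if it has no node of
      height \<alpha> it equals \<open>C\<close>, and \<open>f\<close> is injective.\<close>
    have uniq: "y = p" if y: "y \<in> I" "\<not> longer r (f y) \<alpha>" for y
    proof -
      have yX: "y \<in> topspace X" using y by (simp add: I_def)
      have "node r (f y) \<beta> \<in> f y" if "\<beta> < \<alpha>" for \<beta>
      proof -
        have "y \<in> U \<beta>" using that y(1) by (simp add: I_def)
        then have "y \<in> through \<beta> (z \<beta>)" by (simp only: z(3)[OF that])
        then show ?thesis using nodeI[OF y(1) that] by (simp add: c_def)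
      qed
      then have "f y = C" using y(2) imC[OF y(1)] by (auto simp: longer_def)
      then show ?thesis using p yX f by (auto simp: bij_betw_def inj_on_def)
    qed
    have the: "(THE x. x \<in> I \<and> \<not> longer r (f x) \<alpha>) = p"
      by (rule the_equality) (use pI plong in blast, use uniq in blast)
    have "moves_by (climb X r f) U \<alpha> = Limit_Move P p" using move the 3 by simp
    moreover have "(\<Inter>\<beta>\<in>{..<\<alpha>}. U \<beta>) = I"
      using is_limit_nonempty[OF 3] play_clopen(4)[OF play] by (fastforce simp: I_def)
    moreover have "I = J \<union> {p}" using uniq pI by (auto simp: J_def)
    moreover have "p \<notin> J" using plong by (simp add: J_def)
    ultimately show ?thesis
      unfolding legal_move_limit[OF 3] using p(1) UP cl disj ne by blast
  qed
qed

text \<open>Bob can win only in a limit inning without a legal move, and \<open>climb_legal\<close>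
  shows that no such inning is reached.\<close>

lemma climb_winning: "winning_strategy X (climb X r f)"
proof -
  have "\<not> bob_wins_at X \<alpha> (moves_by (climb X r f) U) U" for \<alpha> U
    using climb_legal[of \<alpha> U] by (auto simp: bob_wins_at_def)
  then show ?thesis
    using climb_legal by (auto simp: winning_strategy_def alice_strategy_def finished_run_def)
qed

end

section \<open>From a coarser ray topology to a winning strategy\<close>

lemma quasi_ray_space_imp_winning:
  assumes "quasi_ray_space X"
  shows "\<exists>\<sigma>. winning_strategy X \<sigma>"
proof -
  obtain X' where X': "topspace X' = topspace X" "\<And>U. openin X' U \<Longrightarrow> openin X U" "ray_space X'"
    using assms by (auto simp: quasi_ray_space_def)
  then obtain T :: "('a \<times> nat) set" and r where tree: "is_tree T r"
    and "X' homeomorphic_space ray_topology T r" by (auto simp: ray_space_def)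
  then obtain f where hf: "homeomorphic_map X' (ray_topology T r) f"
    by (auto simp: homeomorphic_space)
  then have bij: "bij_betw f (topspace X) {R. is_ray T r R}"
    using homeomorphic_imp_surjective_map[OF hf] homeomorphic_imp_injective_map[OF hf]
    by (simp add: bij_betw_def X'(1))
  have cl: "openin X {x \<in> topspace X. t \<in> f x} \<and> closedin X {x \<in> topspace X. t \<in> f x}"
    if t: "t \<in> T" for t
  proof -
    have "continuous_map X' (discrete_topology UNIV) ((\<lambda>R. t \<in> R) \<circ> f)"
      using homeomorphic_imp_continuous_map[OF hf] continuous_map_ray_coordinate[OF t]
      by (rule continuous_map_compose)
    then have o: "openin X' {x \<in> topspace X'. ((\<lambda>R. t \<in> R) \<circ> f) x \<in> S}" for S
      by (rule openin_continuous_map_preimage) simp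
    have "openin X {x \<in> topspace X. t \<in> f x}" "openin X {x \<in> topspace X. t \<notin> f x}"
      using X'(2)[OF o[of "{True}"]] X'(2)[OF o[of "{False}"]] by (simp_all add: X'(1))
    moreover have "topspace X - {x \<in> topspace X. t \<in> f x} = {x \<in> topspace X. t \<notin> f x}" by auto
    ultimately show ?thesis by (simp add: closedin_def)
  qed
  show ?thesis using climb_winning[OF tree bij cl] by blast
qed


section \<open>The runs of the points against a winning strategy\<close>

text \<open>The function passed to \<sigma> is \<open>restrict\<close> written out, so that the
  recursive calls are visibly guarded by \<open>\<beta> < \<alpha>\<close>. When no piece contains
  \<open>x\<close> the value is arbitrary; \<open>run_end\<close> marks the first such
  inning.\<close>

function run :: "'a strategy \<Rightarrow> 'a \<Rightarrow> 'a inning \<Rightarrow> 'a set" where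
  "run \<sigma> x \<alpha> = (THE A. A \<in> pieces (\<sigma> \<alpha> (\<lambda>\<beta>. if \<beta> < \<alpha> then run \<sigma> x \<beta> else undefined)) \<and> x \<in> A)"
  by auto
termination
  by (relation "inv_image {(x, y). x < y} (\<lambda>(\<sigma>, x, \<alpha>). \<alpha>)")
    (rule wf_inv_image, rule wf, auto simp: inv_image_def)

declare run.simps [simp del]

lemma run_eq: "run \<sigma> x \<alpha> = (THE A. A \<in> pieces (moves_by \<sigma> (run \<sigma> x) \<alpha>) \<and> x \<in> A)"
proof -
  have "(\<lambda>\<beta>. if \<beta> < \<alpha> then run \<sigma> x \<beta> else undefined) = restrict (run \<sigma> x) {..<\<alpha>}"
    by (auto simp: restrict_def)
  then show ?thesis by (subst run.simps) (simp add: moves_by_def)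
qed

definition run_end :: "'a strategy \<Rightarrow> 'a \<Rightarrow> 'a inning" where
  "run_end \<sigma> x = (LEAST \<alpha>. x \<notin> \<Union>(pieces (moves_by \<sigma> (run \<sigma> x) \<alpha>)))"

text \<open>The inning is stored separately because \<open>restrict\<close> continues with
  \<open>undefined\<close>, an unspecified set, so the length could not be read off the
  function.\<close>

definition hist :: "'a strategy \<Rightarrow> 'a \<Rightarrow> 'a inning \<Rightarrow> 'a inning \<times> ('a inning \<Rightarrow> 'a set)" where
  "hist \<sigma> x \<alpha> = (\<alpha>, restrict (run \<sigma> x) {..<\<alpha>})"

definition trail :: "'a strategy \<Rightarrow> 'a \<Rightarrow> ('a inning \<times> ('a inning \<Rightarrow> 'a set)) set" where
  "trail \<sigma> x = {hist \<sigma> x \<alpha> | \<alpha>. \<alpha> < run_end \<sigma> x \<and> \<not> is_limit \<alpha>}"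

text \<open>Histories of limit length are left out: all the points that are still in play in a limit
  inning have the same history, and the set of those that remain in play after it, being the union
  of Alice's pieces, need not be closed.\<close>

definition histories :: "'a topology \<Rightarrow> 'a strategy \<Rightarrow> ('a inning \<times> ('a inning \<Rightarrow> 'a set)) set" where
  "histories X \<sigma> = (\<Union>x\<in>topspace X. trail \<sigma> x)"

definition extends :: "'a topology \<Rightarrow> 'a strategy \<Rightarrow> ('a inning \<times> ('a inning \<Rightarrow> 'a set)) rel" where
  "extends X \<sigma> = {(p, q). p \<in> histories X \<sigma> \<and> q \<in> histories X \<sigma> \<and>
     fst p \<le> fst q \<and> snd p = restrict (snd q) {..<fst p}}"

section \<open>End extension of histories\<close>

lemma fst_hist [simp]: "fst (hist \<sigma> x \<alpha>) = \<alpha>"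
  by (simp add: hist_def)

lemma restrict_hist: "\<beta> \<le> \<alpha> \<Longrightarrow> restrict (snd (hist \<sigma> x \<alpha>)) {..<\<beta>} = snd (hist \<sigma> x \<beta>)"
  by (auto simp: hist_def restrict_def fun_eq_iff)

lemma hist_eq_iff: "hist \<sigma> x \<alpha> = hist \<sigma> y \<beta> \<longleftrightarrow> \<alpha> = \<beta> \<and> (\<forall>\<gamma><\<alpha>. run \<sigma> x \<gamma> = run \<sigma> y \<gamma>)"
  by (auto simp: hist_def restrict_def fun_eq_iff)

text \<open>Below a history of \<open>x\<close> there are only earlier histories of the same
  \<open>x\<close>, so on a single run the order reduces to comparing innings.\<close>

lemma extends_hist_iff:
  "(p, hist \<sigma> x \<alpha>) \<in> extends X \<sigma> \<longleftrightarrow>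
     p \<in> histories X \<sigma> \<and> hist \<sigma> x \<alpha> \<in> histories X \<sigma> \<and> fst p \<le> \<alpha> \<and> p = hist \<sigma> x (fst p)"
proof -
  have "snd p = restrict (snd (hist \<sigma> x \<alpha>)) {..<fst p} \<longleftrightarrow> p = hist \<sigma> x (fst p)" if "fst p \<le> \<alpha>"
    by (simp add: restrict_hist[OF that] prod_eq_iff)
  then show ?thesis by (auto simp: extends_def)
qed

lemma hist_in_trail: "hist \<sigma> x \<alpha> \<in> trail \<sigma> x \<longleftrightarrow> \<alpha> < run_end \<sigma> x \<and> \<not> is_limit \<alpha>"
  unfolding trail_def by (auto simp: hist_eq_iff)

lemma trailE:
  assumes "p \<in> trail \<sigma> x"
  obtains "p = hist \<sigma> x (fst p)" "fst p < run_end \<sigma> x" "\<not> is_limit (fst p)"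
  using assms by (auto simp: trail_def)

lemma historiesE:
  assumes "p \<in> histories X \<sigma>"
  obtains x where "x \<in> topspace X" "p = hist \<sigma> x (fst p)" "fst p < run_end \<sigma> x" "\<not> is_limit (fst p)"
  using assms by (auto simp: histories_def elim: trailE)

lemma extends_trans: "trans (extends X \<sigma>)"
proof (rule transI)
  fix p q s assume "(p, q) \<in> extends X \<sigma>" "(q, s) \<in> extends X \<sigma>"
  then show "(p, s) \<in> extends X \<sigma>"
    by (auto simp: extends_def restrict_restrict Int_absorb1 lessThan_subset_iff)
qed

lemma extends_refl:
  assumes p: "p \<in> histories X \<sigma>"
  shows "(p, p) \<in> extends X \<sigma>"
proof -
  obtain x where x: "p = hist \<sigma> x (fst p)" using p by (rule historiesE)
  show ?thesis using extends_hist_iff[of p \<sigma> x "fst p" X] x p by simp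
qed

lemma extends_same_length:
  assumes "(p, q) \<in> extends X \<sigma>" "fst p = fst q"
  shows "p = q"
proof -
  have "q \<in> histories X \<sigma>" using assms(1) by (simp add: extends_def)
  then obtain x where "q = hist \<sigma> x (fst q)" by (rule historiesE)
  with assms show ?thesis by (metis extends_hist_iff)
qed

lemma extends_antisym: "antisym (extends X \<sigma>)"
proof (rule antisymI)
  fix p q assume a: "(p, q) \<in> extends X \<sigma>" "(q, p) \<in> extends X \<sigma>"
  then have "fst p = fst q" by (auto simp: extends_def)
  with a(1) show "p = q" by (rule extends_same_length)
qed

lemma extends_linear:
  assumes "(p, s) \<in> extends X \<sigma>" "(q, s) \<in> extends X \<sigma>" "fst p \<le> fst q"
  shows "(p, q) \<in> extends X \<sigma>"
proof -
  have "s \<in> histories X \<sigma>" using assms(1) by (simp add: extends_def)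
  then obtain x where x: "s = hist \<sigma> x (fst s)" by (rule historiesE)
  have "p = hist \<sigma> x (fst p)" "q = hist \<sigma> x (fst q)" "p \<in> histories X \<sigma>" "q \<in> histories X \<sigma>"
    using assms x by (metis extends_hist_iff)+
  with assms(3) show ?thesis by (metis extends_hist_iff)
qed

section \<open>How the run of a point proceeds and ends\<close>

context
  fixes X :: "'a topology" and \<sigma>
  assumes win: "winning_strategy X \<sigma>"
begin

text \<open>A winning strategy is never stuck: outside limit innings the partition into one piece is
  available, because the space and Bob's sets are non-empty, and a limit inning without a move would
  be a win for Bob.\<close>

lemma winning_legal:
  assumes play: "play X \<alpha> (moves_by \<sigma> U) U" and ne: "topspace X \<noteq> {}"
  shows "legal_move X \<alpha> U (moves_by \<sigma> U \<alpha>)"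
proof -
  have "\<exists>m. legal_move X \<alpha> U m"
  proof (cases \<alpha> rule: inning_cases)
    case 1
    have "partition_on (topspace X) {topspace X}" using ne by (rule partition_on_space)
    then show ?thesis unfolding legal_move_first[OF 1] by auto
  next
    case (2 \<beta>)
    then have "\<beta> < \<alpha>" by (simp add: is_succ_def)
    note cl = play_clopen[OF play this]
    have "partition_on (U \<beta>) {U \<beta>}" using cl(3) by (rule partition_on_space)
    then show ?thesis unfolding legal_move_succ[OF 2] using cl by auto
  next
    case 3
    show ?thesis
    proof (rule ccontr)
      assume no: "\<nexists>m. legal_move X \<alpha> U m"
      with play 3 have "finished_run X \<alpha> (moves_by \<sigma> U) U"
        by (simp add: finished_run_def bob_wins_at_def)
      with win have "alice_wins_at X \<alpha> (moves_by \<sigma> U) U" by (simp add: winning_strategy_def)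
      with no show False by (auto simp: alice_wins_at_def)
    qed
  qed
  with win play show ?thesis by (simp add: winning_strategy_def alice_strategy_def)
qed

lemma play_run_aux:
  assumes x: "x \<in> topspace X"
    and "\<And>\<beta>. \<beta> < \<alpha> \<Longrightarrow> x \<in> \<Union>(pieces (moves_by \<sigma> (run \<sigma> x) \<beta>))"
  shows "play X \<alpha> (moves_by \<sigma> (run \<sigma> x)) (run \<sigma> x) \<and> (\<forall>\<beta><\<alpha>. x \<in> run \<sigma> x \<beta>)"
  using assms(2)
proof (induction \<alpha> rule: less_induct)
  case (less \<alpha>)
  have "legal_move X \<beta> (run \<sigma> x) (moves_by \<sigma> (run \<sigma> x) \<beta>) \<and>
      run \<sigma> x \<beta> \<in> pieces (moves_by \<sigma> (run \<sigma> x) \<beta>) \<and> x \<in> run \<sigma> x \<beta>" if b: "\<beta> < \<alpha>" for \<beta>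
  proof -
    have "play X \<beta> (moves_by \<sigma> (run \<sigma> x)) (run \<sigma> x)"
      using less.IH[OF b] less.prems b by simp
    then have l: "legal_move X \<beta> (run \<sigma> x) (moves_by \<sigma> (run \<sigma> x) \<beta>)"
      using winning_legal x by blast
    obtain A where A: "A \<in> pieces (moves_by \<sigma> (run \<sigma> x) \<beta>)" "x \<in> A" using less.prems[OF b] by blast
    have unique: "B = A" if "B \<in> pieces (moves_by \<sigma> (run \<sigma> x) \<beta>)" "x \<in> B" for B
      using disjointD[OF legal_move_pieces(1)[OF l] that(1) A(1)] that(2) A(2) by blast
    have "run \<sigma> x \<beta> = A"
      unfolding run_eq[of \<sigma> x \<beta>] by (rule the_equality) (use A unique in blast)+
    with A l show ?thesis by simp
  qed
  then show ?case by (simp add: play_def)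
qed

text \<open>If \<open>x\<close> always lay in a piece, its run would pass through all innings,
  contrary to \<open>run_terminates\<close>. So the \<open>LEAST\<close> in \<open>run_end\<close>
  is attained.\<close>

lemma run_end_not_in:
  assumes "x \<in> topspace X"
  shows "x \<notin> \<Union>(pieces (moves_by \<sigma> (run \<sigma> x) (run_end \<sigma> x)))"
proof -
  obtain \<alpha> where "\<not> play X \<alpha> (moves_by \<sigma> (run \<sigma> x)) (run \<sigma> x)"
    using run_terminates by blast
  then have "\<exists>\<beta>. x \<notin> \<Union>(pieces (moves_by \<sigma> (run \<sigma> x) \<beta>))"
    using play_run_aux[OF assms] by blast
  then show ?thesis unfolding run_end_def by (rule LeastI_ex)
qed

text \<open>Pieces are disjoint, so a point lying in all of Bob's sets forces the same picks, and
  against the same picks Alice repeats her moves. This identifies the runs of different points as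
  long as they stay together.\<close>

lemma run_of_point:
  assumes play: "play X \<alpha> (moves_by \<sigma> U) U"
    and xX: "x \<in> topspace X" and x: "\<And>\<beta>. \<beta> < \<alpha> \<Longrightarrow> x \<in> U \<beta>"
  shows "\<beta> < \<alpha> \<Longrightarrow> run \<sigma> x \<beta> = U \<beta>" and "\<alpha> \<le> run_end \<sigma> x"
proof -
  have eq: "run \<sigma> x \<beta> = U \<beta>" "x \<in> \<Union>(pieces (moves_by \<sigma> (run \<sigma> x) \<beta>))" if "\<beta> < \<alpha>" for \<beta>
    using that
  proof (induction \<beta> rule: less_induct)
    case (less \<beta>)
    {
      case 1
      have m: "moves_by \<sigma> (run \<sigma> x) \<beta> = moves_by \<sigma> U \<beta>"
        using less 1 by (intro moves_by_cong) simp
      have U: "legal_move X \<beta> U (moves_by \<sigma> U \<beta>)" "U \<beta> \<in> pieces (moves_by \<sigma> U \<beta>)"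
        using play 1 by (auto simp: play_def)
      have unique: "A = U \<beta>" if "A \<in> pieces (moves_by \<sigma> U \<beta>)" "x \<in> A" for A
        using disjointD[OF legal_move_pieces(1)[OF U(1)] that(1) U(2)] that(2) x[OF 1] by blast
      show "run \<sigma> x \<beta> = U \<beta>"
        unfolding run_eq[of \<sigma> x \<beta>] m by (rule the_equality) (use U x[OF 1] unique in blast)+
    next
      case 2
      have "moves_by \<sigma> (run \<sigma> x) \<beta> = moves_by \<sigma> U \<beta>"
        using less 2 by (intro moves_by_cong) simp
      then show "x \<in> \<Union>(pieces (moves_by \<sigma> (run \<sigma> x) \<beta>))"
        using play 2 x[OF 2] by (auto simp: play_def)
    }
  qed
  then show "\<beta> < \<alpha> \<Longrightarrow> run \<sigma> x \<beta> = U \<beta>" by simp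
  show "\<alpha> \<le> run_end \<sigma> x"
  proof (rule ccontr)
    assume "\<not> \<alpha> \<le> run_end \<sigma> x"
    then have "x \<in> \<Union>(pieces (moves_by \<sigma> (run \<sigma> x) (run_end \<sigma> x)))" using eq(2) by simp
    with run_end_not_in[OF xX] show False by blast
  qed
qed

lemma play_run:
  assumes "x \<in> topspace X" "\<alpha> \<le> run_end \<sigma> x"
  shows "play X \<alpha> (moves_by \<sigma> (run \<sigma> x)) (run \<sigma> x)" "\<And>\<beta>. \<beta> < \<alpha> \<Longrightarrow> x \<in> run \<sigma> x \<beta>"
proof -
  have "x \<in> \<Union>(pieces (moves_by \<sigma> (run \<sigma> x) \<beta>))" if "\<beta> < \<alpha>" for \<beta>
    using not_less_Least[of \<beta> "\<lambda>\<alpha>. x \<notin> \<Union>(pieces (moves_by \<sigma> (run \<sigma> x) \<alpha>))"] that assms(2)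
    unfolding run_end_def by fastforce
  from play_run_aux[OF assms(1) this]
  show "play X \<alpha> (moves_by \<sigma> (run \<sigma> x)) (run \<sigma> x)" "\<And>\<beta>. \<beta> < \<alpha> \<Longrightarrow> x \<in> run \<sigma> x \<beta>" by auto
qed

text \<open>In all other innings the pieces cover what is in play, so \<open>x\<close> can drop out
  only in a limit inning, where the one point left uncovered is the one Alice plays.\<close>

lemma run_end_limit:
  assumes x: "x \<in> topspace X"
  shows "is_limit (run_end \<sigma> x)" "point (moves_by \<sigma> (run \<sigma> x) (run_end \<sigma> x)) = x"
proof -
  let ?l = "run_end \<sigma> x" and ?m = "moves_by \<sigma> (run \<sigma> x) (run_end \<sigma> x)"
  note play = play_run[OF x order_refl]
  have l: "legal_move X ?l (run \<sigma> x) ?m" using winning_legal play(1) x by blast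
  have out: "x \<notin> \<Union>(pieces ?m)" by (rule run_end_not_in[OF x])
  show lim: "is_limit ?l"
  proof (cases ?l rule: inning_cases)
    case 1
    then have "\<Union>(pieces ?m) = topspace X" using l by (auto simp: legal_move_first partition_on_def)
    then show ?thesis using out x by blast
  next
    case (2 \<beta>)
    then have "x \<in> run \<sigma> x \<beta>" using play(2) by (simp add: is_succ_def)
    moreover have "\<Union>(pieces ?m) = run \<sigma> x \<beta>"
      using l by (auto simp: legal_move_succ[OF 2] partition_on_def)
    ultimately show ?thesis using out by blast
  qed
  obtain P y where Py: "?m = Limit_Move P y" "(\<Inter>\<beta>\<in>{..<?l}. run \<sigma> x \<beta>) = \<Union>P \<union> {y}"
    using l unfolding legal_move_limit[OF lim] by blast
  have "x \<in> (\<Inter>\<beta>\<in>{..<?l}. run \<sigma> x \<beta>)" using play(2) by simp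
  then have "x = y" using out Py by simp
  then show "point ?m = x" using Py by simp
qed

text \<open>Source of the clopen sets: Bob's sets decrease, so being in the last one before \<alpha>
  already means sharing the whole history up to \<alpha>.\<close>

lemma hist_in_other_trail:
  assumes x: "x \<in> topspace X" and \<alpha>: "\<alpha> < run_end \<sigma> x" "is_succ \<beta> \<alpha>"
  shows "y \<in> topspace X \<and> hist \<sigma> x \<alpha> \<in> trail \<sigma> y \<longleftrightarrow> y \<in> run \<sigma> x \<beta>"
proof
  have ba: "\<beta> < \<alpha>" using \<alpha>(2) by (simp add: is_succ_def)
  assume y: "y \<in> topspace X \<and> hist \<sigma> x \<alpha> \<in> trail \<sigma> y"
  then have "hist \<sigma> x \<alpha> = hist \<sigma> y \<alpha>" "\<alpha> < run_end \<sigma> y" by (auto elim: trailE)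
  then show "y \<in> run \<sigma> x \<beta>" using y ba play_run(2)[of y \<alpha> \<beta>] by (simp add: hist_eq_iff)
next
  assume y: "y \<in> run \<sigma> x \<beta>"
  have ba: "\<beta> < \<alpha>" using \<alpha>(2) by (simp add: is_succ_def)
  have play: "play X \<alpha> (moves_by \<sigma> (run \<sigma> x)) (run \<sigma> x)" using play_run x \<alpha>(1) by simp
  have yX: "y \<in> topspace X" using play_clopen(4)[OF play ba] y by blast
  have "y \<in> run \<sigma> x \<gamma>" if "\<gamma> < \<alpha>" for \<gamma>
    using play_antimono[OF play _ ba] y that is_succ_less_iff[OF \<alpha>(2)] by blast
  note r = run_of_point[OF play yX this]
  have nl: "\<not> is_limit \<alpha>" using \<alpha>(2) is_limitD by blast
  \<comment> \<open>\<open>run_of_point\<close> gives only \<le>; equality is impossible because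
    runs end in limit innings and \<alpha> is a successor.\<close>
  moreover have "\<alpha> < run_end \<sigma> y" using r(2) run_end_limit(1)[OF yX] nl by (metis le_less)
  ultimately have "hist \<sigma> y \<alpha> \<in> trail \<sigma> y" by (simp add: hist_in_trail)
  moreover have "hist \<sigma> y \<alpha> = hist \<sigma> x \<alpha>" using r(1) by (simp add: hist_eq_iff)
  ultimately show "y \<in> topspace X \<and> hist \<sigma> x \<alpha> \<in> trail \<sigma> y" using yX by simp
qed

section \<open>The tree of histories and its rays\<close>

lemma first_in_trail:
  assumes "x \<in> topspace X" "is_first \<alpha>"
  shows "hist \<sigma> x \<alpha> \<in> trail \<sigma> x"
proof -
  have "\<alpha> \<noteq> run_end \<sigma> x" "\<not> is_limit \<alpha>" "\<alpha> \<le> run_end \<sigma> x"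
    using assms run_end_limit(1) is_limitD(1) by (auto simp: is_first_def)
  then show ?thesis by (simp add: hist_in_trail)
qed

lemma ex_first: "\<exists>\<alpha> :: 'a inning. is_first \<alpha>"
proof -
  obtain \<mu> :: "'a inning" where "\<forall>\<beta>. \<not> \<beta> < \<mu>"
    using wf_eq_minimal[THEN iffD1, OF wf, rule_format, of _ UNIV] by auto
  then show ?thesis by (auto simp: is_first_def not_less)
qed

text \<open>The empty history, common to all points, is the root. Proper extension raises the
  inning, so well-foundedness is inherited from the innings.\<close>

lemma histories_tree:
  assumes "topspace X \<noteq> {}"
  shows "is_tree (histories X \<sigma>) (extends X \<sigma>)"
  unfolding is_tree_def
proof (intro conjI ballI)
  let ?H = "histories X \<sigma>" and ?r = "extends X \<sigma>"
  have sub: "?r \<subseteq> ?H \<times> ?H" by (auto simp: extends_def)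
  show "partial_order_on ?H ?r"
    unfolding partial_order_on_def preorder_on_def
    using sub extends_trans extends_antisym by (intro conjI refl_onI extends_refl) auto
  obtain \<mu> :: "'a inning" where \<mu>: "is_first \<mu>" using ex_first by blast
  obtain x where x: "x \<in> topspace X" using assms by blast
  have root: "hist \<sigma> x \<mu> \<in> ?H" using first_in_trail[OF x \<mu>] x by (auto simp: histories_def)
  have "(hist \<sigma> x \<mu>, q) \<in> ?r" if "q \<in> ?H" for q
  proof -
    obtain y where y: "q = hist \<sigma> y (fst q)" using \<open>q \<in> ?H\<close> by (rule historiesE)
    have "hist \<sigma> x \<mu> = hist \<sigma> y \<mu>" using \<mu> by (simp add: hist_eq_iff is_first_not_less)
    moreover have "\<mu> \<le> fst q" using \<mu> by (simp add: is_first_def)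
    ultimately have "(hist \<sigma> x \<mu>, hist \<sigma> y (fst q)) \<in> ?r"
      using root that y by (metis extends_hist_iff fst_hist)
    with y show ?thesis by simp
  qed
  with root show "\<exists>m\<in>?H. \<forall>t\<in>?H. (m, t) \<in> ?r" by blast
  fix t assume t: "t \<in> ?H"
  let ?A = "{s \<in> ?H. (s, t) \<in> ?r}"
  show "well_order_on ?A (Restr ?r ?A)"
    unfolding well_order_on_def linear_order_on_def partial_order_on_def preorder_on_def
  proof (intro conjI)
    show "Restr ?r ?A \<subseteq> ?A \<times> ?A" by auto
    show "refl_on ?A (Restr ?r ?A)" by (intro refl_onI) (simp add: extends_refl)
    show "trans (Restr ?r ?A)" using extends_trans by (rule trans_Restr)
    show "antisym (Restr ?r ?A)" using extends_antisym by (rule antisym_subset[OF Int_lower1])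
    show "total_on ?A (Restr ?r ?A)"
    proof (rule total_onI)
      fix p q assume pq: "p \<in> ?A" "q \<in> ?A"
      then have "(p, q) \<in> ?r \<or> (q, p) \<in> ?r"
        using extends_linear[of p t X \<sigma> q] extends_linear[of q t X \<sigma> p] linear[of "fst p" "fst q"]
        by blast
      with pq show "(p, q) \<in> Restr ?r ?A \<or> (q, p) \<in> Restr ?r ?A" by blast
    qed
    show "wf (Restr ?r ?A - Id)"
    proof (rule wf_subset)
      show "wf (inv_image {(\<alpha>, \<beta>). \<alpha> < \<beta>} (fst :: _ \<Rightarrow> 'a inning))" by (rule wf_inv_image) (rule wf)
      show "Restr ?r ?A - Id \<subseteq> inv_image {(\<alpha>, \<beta>). \<alpha> < \<beta>} fst"
      proof
        fix z assume z: "z \<in> Restr ?r ?A - Id"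
        then obtain p q where pq: "z = (p, q)" "(p, q) \<in> ?r" "p \<noteq> q" by auto
        then have "fst p \<noteq> fst q" using extends_same_length by blast
        moreover have "fst p \<le> fst q" using pq by (simp add: extends_def)
        ultimately show "z \<in> inv_image {(\<alpha>, \<beta>). \<alpha> < \<beta>} fst" using pq by (simp add: inv_image_def)
      qed
    qed
  qed
qed

text \<open>There is no maximal element although limit histories are missing: the end of a run is a
  limit, so the successor of each inning of the trail still comes before it, and successors are
  kept.\<close>

lemma trail_ray:
  assumes x: "x \<in> topspace X"
  shows "is_ray (histories X \<sigma>) (extends X \<sigma>) (trail \<sigma> x)"
  unfolding is_ray_def
proof (intro conjI ballI impI)
  show "trail \<sigma> x \<subseteq> histories X \<sigma>" using x by (auto simp: histories_def)
  show "trail \<sigma> x \<noteq> {}" using first_in_trail[OF x] ex_first by blast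
next
  fix t s assume t: "t \<in> trail \<sigma> x" and s: "s \<in> histories X \<sigma>" and st: "(s, t) \<in> extends X \<sigma>"
  from t have t': "t = hist \<sigma> x (fst t)" "fst t < run_end \<sigma> x" by (auto elim: trailE)
  then have "s = hist \<sigma> x (fst s)" "fst s \<le> fst t" using st by (metis extends_hist_iff)+
  moreover have "\<not> is_limit (fst s)" using s by (rule historiesE)
  ultimately show "s \<in> trail \<sigma> x" using t' hist_in_trail by (metis le_less_trans)
next
  fix s t assume st: "s \<in> trail \<sigma> x" "t \<in> trail \<sigma> x"
  then have "s = hist \<sigma> x (fst s)" "t = hist \<sigma> x (fst t)" "s \<in> histories X \<sigma>" "t \<in> histories X \<sigma>"
    using x by (auto elim: trailE simp: histories_def)
  then show "(s, t) \<in> extends X \<sigma> \<or> (t, s) \<in> extends X \<sigma>" by (metis extends_hist_iff linear)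
next
  show "\<not> (\<exists>m\<in>trail \<sigma> x. \<forall>t\<in>trail \<sigma> x. (m, t) \<in> extends X \<sigma> \<longrightarrow> t = m)"
  proof
    assume "\<exists>m\<in>trail \<sigma> x. \<forall>t\<in>trail \<sigma> x. (m, t) \<in> extends X \<sigma> \<longrightarrow> t = m"
    then obtain m where m: "m \<in> trail \<sigma> x" "\<And>t. t \<in> trail \<sigma> x \<Longrightarrow> (m, t) \<in> extends X \<sigma> \<Longrightarrow> t = m"
      by blast
    then have m': "m = hist \<sigma> x (fst m)" "fst m < run_end \<sigma> x" by (auto elim: trailE)
    obtain \<gamma> where g: "\<gamma> < run_end \<sigma> x" "is_succ (fst m) \<gamma>"
      using is_limit_succ[OF run_end_limit(1)[OF x] m'(2)] by blast
    then have "hist \<sigma> x \<gamma> \<in> trail \<sigma> x" using is_limitD(2) by (simp add: hist_in_trail) blast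
    moreover from this have "(m, hist \<sigma> x \<gamma>) \<in> extends X \<sigma>"
      using m(1) m'(1) g(2) x by (auto simp: extends_hist_iff histories_def is_succ_def)
    ultimately have "hist \<sigma> x \<gamma> = m" using m(2) by blast
    then show False using g(2) by (auto simp: is_succ_def)
  qed
qed

text \<open>A trail determines the run up to its end. Equal trails therefore make Alice play the
  same move in the final inning, and the point of that move is the point of the run.\<close>

lemma trail_inj: "inj_on (trail \<sigma>) (topspace X)"
proof (rule inj_onI)
  fix x y assume x: "x \<in> topspace X" and y: "y \<in> topspace X" and eq: "trail \<sigma> x = trail \<sigma> y"
  have agree: "run_end \<sigma> u \<le> run_end \<sigma> v \<and> (\<forall>\<beta><run_end \<sigma> u. run \<sigma> u \<beta> = run \<sigma> v \<beta>)"
    if "u \<in> topspace X" "v \<in> topspace X" "trail \<sigma> u = trail \<sigma> v" for u v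
  proof -
    have "\<beta> < run_end \<sigma> v \<and> run \<sigma> u \<beta> = run \<sigma> v \<beta>" if b: "\<beta> < run_end \<sigma> u" for \<beta>
    proof -
      \<comment> \<open>The pick in inning \<beta> is recorded only in longer histories; the first
        of these has successor length, so it was not left out.\<close>
      obtain \<gamma> where g: "\<gamma> < run_end \<sigma> u" "is_succ \<beta> \<gamma>"
        using is_limit_succ[OF run_end_limit(1)[OF \<open>u \<in> _\<close>] b] by blast
      then have "hist \<sigma> u \<gamma> \<in> trail \<sigma> v"
        using is_limitD(2) by (simp add: hist_in_trail flip: \<open>trail \<sigma> u = _\<close>) blast
      then have "hist \<sigma> u \<gamma> = hist \<sigma> v \<gamma>" "\<gamma> < run_end \<sigma> v" by (auto elim: trailE)
      then show ?thesis using g(2) by (auto simp: hist_eq_iff is_succ_def)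
    qed
    then show ?thesis by (meson not_le less_irrefl)
  qed
  have e: "run_end \<sigma> x = run_end \<sigma> y" using agree[OF x y eq] agree[OF y x eq[symmetric]] by (blast intro: order_antisym)
  have "moves_by \<sigma> (run \<sigma> x) (run_end \<sigma> x) = moves_by \<sigma> (run \<sigma> y) (run_end \<sigma> x)"
    using agree[OF x y eq] by (intro moves_by_cong) simp
  then show "x = y" using run_end_limit(2)[OF x] run_end_limit(2)[OF y] e by metis
qed

text \<open>The histories in \<open>R\<close> glue to a play \<open>U\<close> that stops at a limit
  inning \<mu>. Winning gives Alice a move there, and its point lies in all of Bob's sets, so its
  run is \<open>U\<close>.\<close>

lemma trail_surj:
  assumes ne: "topspace X \<noteq> {}" and R: "is_ray (histories X \<sigma>) (extends X \<sigma>) R"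
  shows "\<exists>x\<in>topspace X. trail \<sigma> x = R"
proof -
  let ?H = "histories X \<sigma>" and ?r = "extends X \<sigma>"
  have RH: "R \<subseteq> ?H" and down: "\<And>t s. \<lbrakk>t \<in> R; (s, t) \<in> ?r\<rbrakk> \<Longrightarrow> s \<in> R"
    and chain: "\<And>s t. \<lbrakk>s \<in> R; t \<in> R\<rbrakk> \<Longrightarrow> (s, t) \<in> ?r \<or> (t, s) \<in> ?r"
    and nomax: "\<And>m. m \<in> R \<Longrightarrow> \<exists>t\<in>R. (m, t) \<in> ?r \<and> t \<noteq> m"
    using R unfolding is_ray_def extends_def by blast+
  have "\<forall>p\<in>R. \<exists>x. x \<in> topspace X \<and> p = hist \<sigma> x (fst p) \<and> fst p < run_end \<sigma> x \<and> \<not> is_limit (fst p)"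
    using RH by (meson historiesE subsetD)
  then obtain z where z: "\<And>p. p \<in> R \<Longrightarrow> z p \<in> topspace X" "\<And>p. p \<in> R \<Longrightarrow> p = hist \<sigma> (z p) (fst p)"
    "\<And>p. p \<in> R \<Longrightarrow> fst p < run_end \<sigma> (z p)" "\<And>p. p \<in> R \<Longrightarrow> \<not> is_limit (fst p)"
    by metis
  have extends_iff: "(s, p) \<in> ?r \<longleftrightarrow> s \<in> ?H \<and> fst s \<le> fst p \<and> s = hist \<sigma> (z p) (fst s)"
    if "p \<in> R" for p s
    using extends_hist_iff[of s \<sigma> "z p" "fst p" X, folded z(2)[OF that]] that RH by auto
  have coh: "run \<sigma> (z p) \<beta> = run \<sigma> (z q) \<beta>" if "p \<in> R" "q \<in> R" "\<beta> < fst p" "\<beta> < fst q" for p q \<beta>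
  proof -
    have *: "run \<sigma> (z p) \<beta> = run \<sigma> (z q) \<beta>" if "p \<in> R" "q \<in> R" "\<beta> < fst p" "(p, q) \<in> ?r" for p q
    proof -
      have "p = hist \<sigma> (z q) (fst p)" using that by (simp add: extends_iff)
      then have "hist \<sigma> (z p) (fst p) = hist \<sigma> (z q) (fst p)" using z(2)[of p] that by simp
      then show ?thesis using that by (simp add: hist_eq_iff)
    qed
    show ?thesis using chain[OF that(1,2)] *[of p q] *[of q p] that by auto
  qed
  \<comment> \<open>The points \<open>z p\<close> may differ, but by \<open>coh\<close> their runs
    agree wherever both histories reach, so the choice made here does not matter.\<close>
  define U where "U = (\<lambda>\<beta>. run \<sigma> (z (SOME p. p \<in> R \<and> \<beta> < fst p)) \<beta>)"
  have U: "run \<sigma> (z p) \<beta> = U \<beta>" if "p \<in> R" "\<beta> < fst p" for p \<beta>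
  proof -
    have "(SOME p. p \<in> R \<and> \<beta> < fst p) \<in> R \<and> \<beta> < fst (SOME p. p \<in> R \<and> \<beta> < fst p)"
      using that by (intro someI_ex[of "\<lambda>p. p \<in> R \<and> \<beta> < fst p"]) blast
    then show ?thesis unfolding U_def using that by (intro coh) auto
  qed
  \<comment> \<open>Cutting \<open>p\<close> off just after inning \<beta> leaves a history of
    successor length; it belongs to the tree, hence to the downward closed \<open>R\<close>.\<close>
  have up: "\<exists>q\<in>R. is_succ \<beta> (fst q)" if p: "p \<in> R" "\<beta> < fst p" for p \<beta>
  proof -
    obtain \<gamma> where g: "is_succ \<beta> \<gamma>" "\<gamma> \<le> fst p" using is_succ_exists p(2) by blast
    have "\<gamma> < run_end \<sigma> (z p)" "\<not> is_limit \<gamma>" using g z(3)[OF p(1)] is_limitD(2) by auto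
    then have "hist \<sigma> (z p) \<gamma> \<in> trail \<sigma> (z p)" by (simp add: hist_in_trail)
    then have "hist \<sigma> (z p) \<gamma> \<in> ?H" using z(1)[OF p(1)] unfolding histories_def by blast
    then have "(hist \<sigma> (z p) \<gamma>, p) \<in> ?r" using g(2) by (simp add: extends_iff[OF p(1)])
    then have "hist \<sigma> (z p) \<gamma> \<in> R" by (rule down[OF p(1)])
    then show ?thesis using g(1) by (intro bexI[of _ "hist \<sigma> (z p) \<gamma>"]) simp_all
  qed
  have longer: "\<exists>q\<in>R. fst p < fst q" if p: "p \<in> R" for p
  proof -
    obtain q where q: "q \<in> R" "(p, q) \<in> ?r" "q \<noteq> p" using nomax[OF p] by blast
    then have "fst p \<noteq> fst q" using extends_same_length by blast
    moreover have "fst p \<le> fst q" using q by (simp add: extends_def)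
    ultimately show ?thesis using q(1) le_neq_trans by blast
  qed
  have play: "play X (fst p) (moves_by \<sigma> U) U" if p: "p \<in> R" for p
  proof -
    have "play X (fst p) (moves_by \<sigma> (run \<sigma> (z p))) (run \<sigma> (z p))"
      using play_run(1)[OF z(1)[OF p]] z(3)[OF p] by simp
    then show ?thesis using play_moves_by_cong[of "fst p" "run \<sigma> (z p)" U] U[OF p] by simp
  qed
  define D where "D = {\<beta>. \<exists>p\<in>R. \<beta> < fst p}"
  \<comment> \<open>\<open>D\<close> collects the innings covered by \<open>R\<close>. If it
    contained all innings, \<open>U\<close> would be an endless play.\<close>
  have "\<exists>\<alpha>. \<alpha> \<notin> D"
  proof (rule ccontr)
    assume "\<nexists>\<alpha>. \<alpha> \<notin> D"
    have "play X \<alpha> (moves_by \<sigma> U) U" for \<alpha>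
    proof -
      obtain p where "p \<in> R" "\<alpha> < fst p" using \<open>\<nexists>\<alpha>. \<alpha> \<notin> D\<close> unfolding D_def by blast
      then show ?thesis using play_mono[OF play] by simp
    qed
    then show False using run_terminates by blast
  qed
  define \<mu> where "\<mu> = (LEAST \<alpha>. \<alpha> \<notin> D)"
  have out: "\<mu> \<notin> D" unfolding \<mu>_def using \<open>\<exists>\<alpha>. \<alpha> \<notin> D\<close> by (rule LeastI_ex)
  have D: "\<beta> \<in> D \<longleftrightarrow> \<beta> < \<mu>" for \<beta>
  proof
    assume "\<beta> \<in> D"
    then obtain p where "p \<in> R" "\<beta> < fst p" by (auto simp: D_def)
    moreover have "\<not> \<mu> < fst p" using out \<open>p \<in> R\<close> by (auto simp: D_def)
    ultimately show "\<beta> < \<mu>" by simp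
  next
    show "\<beta> < \<mu> \<Longrightarrow> \<beta> \<in> D" using not_less_Least[of \<beta> "\<lambda>\<alpha>. \<alpha> \<notin> D"] unfolding \<mu>_def by blast
  qed
  have below: "fst p < \<mu>" if "p \<in> R" for p using longer[OF that] D unfolding D_def by blast
  have lim: "is_limit \<mu>"
    unfolding is_limit_def
  proof
    obtain p where "p \<in> R" using R by (auto simp: is_ray_def)
    then show "\<not> is_first \<mu>" using below is_first_not_less by blast
    \<comment> \<open>Were \<mu> the successor of \<beta>, \<open>up\<close> would give a history in
      \<open>R\<close> whose length lies strictly between \<beta> and \<mu>.\<close>
    show "\<nexists>\<beta>. is_succ \<beta> \<mu>"
    proof
      assume "\<exists>\<beta>. is_succ \<beta> \<mu>"
      then obtain \<beta> where b: "is_succ \<beta> \<mu>" by blast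
      then have "\<beta> \<in> D" by (simp add: D is_succ_def)
      then obtain p q where q: "p \<in> R" "\<beta> < fst p" "q \<in> R" "is_succ \<beta> (fst q)"
        using up unfolding D_def by blast
      then have "fst q < \<mu>" "\<beta> < fst q" using below by (auto simp: is_succ_def)
      with b show False by (auto simp: is_succ_def)
    qed
  qed
  have playL: "play X \<mu> (moves_by \<sigma> U) U"
    unfolding play_def
  proof (intro allI impI)
    fix \<beta> assume "\<beta> < \<mu>"
    then obtain p where "p \<in> R" "\<beta> < fst p" using D unfolding D_def by blast
    with play show "legal_move X \<beta> U (moves_by \<sigma> U \<beta>) \<and> U \<beta> \<in> pieces (moves_by \<sigma> U \<beta>)"
      by (simp add: play_def)
  qed
  then have "legal_move X \<mu> U (moves_by \<sigma> U \<mu>)" using winning_legal ne by blast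
  then obtain P x where Px: "moves_by \<sigma> U \<mu> = Limit_Move P x" "x \<in> topspace X"
    "(\<Inter>\<beta>\<in>{..<\<mu>}. U \<beta>) = \<Union>P \<union> {x}" "x \<notin> \<Union>P"
    unfolding legal_move_limit[OF lim] by blast
  have "x \<in> (\<Inter>\<beta>\<in>{..<\<mu>}. U \<beta>)" using Px(3) by simp
  then have "x \<in> U \<beta>" if "\<beta> < \<mu>" for \<beta> using that by simp
  \<comment> \<open>The run of Alice's point follows \<open>U\<close> up to \<mu>; since no piece
    played there contains the point, its run ends exactly at \<mu>.\<close>
  note run_x = run_of_point[OF playL Px(2) this]
  have "moves_by \<sigma> (run \<sigma> x) \<mu> = moves_by \<sigma> U \<mu>" using run_x(1) by (rule moves_by_cong)
  then have "x \<notin> \<Union>(pieces (moves_by \<sigma> (run \<sigma> x) \<mu>))" using Px by simp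
  then have "run_end \<sigma> x \<le> \<mu>" unfolding run_end_def by (rule Least_le)
  with run_x(2) have end_x: "run_end \<sigma> x = \<mu>" by simp
  have hist_x: "hist \<sigma> x (fst p) = p" if "p \<in> R" for p
  proof -
    have "hist \<sigma> x (fst p) = hist \<sigma> (z p) (fst p)"
      using U[OF that] run_x(1) below[OF that] by (simp add: hist_eq_iff)
    then show ?thesis using z(2)[OF that] by simp
  qed
  have "R \<subseteq> trail \<sigma> x"
  proof
    fix p assume p: "p \<in> R"
    have "hist \<sigma> x (fst p) \<in> trail \<sigma> x" using below[OF p] z(4)[OF p] end_x by (simp add: hist_in_trail)
    then show "p \<in> trail \<sigma> x" by (simp add: hist_x[OF p])
  qed
  moreover have "trail \<sigma> x \<subseteq> R"
  proof
    fix q assume q: "q \<in> trail \<sigma> x"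
    then have q': "q = hist \<sigma> x (fst q)" "fst q < \<mu>" using end_x by (auto elim: trailE)
    then obtain p where p: "p \<in> R" "fst q < fst p" using D unfolding D_def by blast
    have "q \<in> ?H" using q Px(2) by (auto simp: histories_def)
    then have "(q, p) \<in> ?r"
      using extends_hist_iff[of q \<sigma> x "fst p" X] q'(1) p RH unfolding hist_x[OF p(1)] by auto
    then show "q \<in> R" by (rule down[OF p(1)])
  qed
  ultimately show ?thesis using Px(2) by blast
qed

section \<open>Continuity of \<open>trail\<close> and the coarser topology\<close>

text \<open>With limit lengths excluded only two cases remain: all points share the empty history,
  and a history of successor length is shared by the points of a set that Bob picked.\<close>

lemma trail_clopen:
  assumes p: "p \<in> histories X \<sigma>"
  shows "openin X {y \<in> topspace X. p \<in> trail \<sigma> y} \<and> closedin X {y \<in> topspace X. p \<in> trail \<sigma> y}"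
proof -
  obtain x where x: "x \<in> topspace X" "p = hist \<sigma> x (fst p)" "fst p < run_end \<sigma> x" "\<not> is_limit (fst p)"
    using p by (rule historiesE)
  show ?thesis
  proof (cases "fst p" rule: inning_cases)
    case 1
    have "p \<in> trail \<sigma> y" if "y \<in> topspace X" for y
    proof -
      have "hist \<sigma> x (fst p) = hist \<sigma> y (fst p)" using 1 by (simp add: hist_eq_iff is_first_not_less)
      then show ?thesis using first_in_trail[OF that 1] x(2) by simp
    qed
    then have "{y \<in> topspace X. p \<in> trail \<sigma> y} = topspace X" by auto
    then show ?thesis by simp
  next
    case (2 \<beta>)
    have "{y \<in> topspace X. p \<in> trail \<sigma> y} = run \<sigma> x \<beta>"
      using hist_in_other_trail[OF x(1,3) 2] x(2) by auto
    moreover have "\<beta> < run_end \<sigma> x" using x(3) 2 by (auto simp: is_succ_def)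
    ultimately show ?thesis using play_clopen(1,2)[OF play_run(1)[OF x(1) order_refl]] by simp
  qed (use x(4) in blast)
qed

end

text \<open>The pullback is the coarsest topology that makes \<open>trail\<close> continuous. It
  lies inside that of \<open>X\<close> because \<open>trail\<close> is continuous on
  \<open>X\<close>, and for it the bijection \<open>trail\<close> is a homeomorphism.\<close>

lemma winning_imp_quasi_ray_space:
  assumes ne: "topspace X \<noteq> {}" and win: "winning_strategy X \<sigma>"
  shows "quasi_ray_space X"
proof -
  let ?Y = "ray_topology (histories X \<sigma>) (extends X \<sigma>)"
  let ?X' = "pullback_topology (topspace X) (trail \<sigma>) ?Y"
  note ray = trail_ray[OF win] and surj = trail_surj[OF win ne]
  have top: "topspace ?X' = topspace X"
    using ray by (auto simp: topspace_pullback_topology)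
  have cont: "continuous_map X ?Y (trail \<sigma>)"
  proof (rule continuous_map_into_ray_topology)
    fix t assume t: "t \<in> histories X \<sigma>"
    show "continuous_map X (discrete_topology UNIV) (\<lambda>x. t \<in> trail \<sigma> x)"
      unfolding continuous_map_def
    proof (intro conjI allI impI)
      fix S :: "bool set"
      let ?A = "{x \<in> topspace X. t \<in> trail \<sigma> x}"
      have "openin X ?A" "openin X (topspace X - ?A)" using trail_clopen[OF win t] by auto
      moreover have "{x \<in> topspace X. (t \<in> trail \<sigma> x) \<in> S} =
          (if True \<in> S then ?A else {}) \<union> (if False \<in> S then topspace X - ?A else {})"
      proof (rule set_eqI)
        fix x
        show "x \<in> {x \<in> topspace X. (t \<in> trail \<sigma> x) \<in> S} \<longleftrightarrow>
            x \<in> (if True \<in> S then ?A else {}) \<union> (if False \<in> S then topspace X - ?A else {})"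
          by (cases "t \<in> trail \<sigma> x") auto
      qed
      ultimately show "openin X {x \<in> topspace X. (t \<in> trail \<sigma> x) \<in> S}" by auto
    qed simp
  qed (rule ray)
  have openX': "\<exists>V. openin ?Y V \<and> U = trail \<sigma> -` V \<inter> topspace X" if "openin ?X' U" for U
    using that by (rule openin_pullback_topology[THEN iffD1])
  have coarser: "openin X U" if U: "openin ?X' U" for U
  proof -
    obtain V where V: "openin ?Y V" "U = trail \<sigma> -` V \<inter> topspace X"
      using openX'[OF U] by blast
    have "openin X {x \<in> topspace X. trail \<sigma> x \<in> V}"
      using cont V(1) by (rule openin_continuous_map_preimage)
    moreover have "{x \<in> topspace X. trail \<sigma> x \<in> V} = U" using V(2) by auto
    ultimately show ?thesis by simp
  qed
  have img: "trail \<sigma> ` topspace X = topspace ?Y"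
    unfolding topspace_ray_topology using ray surj by blast
  have "homeomorphic_map ?X' ?Y (trail \<sigma>)"
  proof (rule bijective_open_imp_homeomorphic_map)
    show "continuous_map ?X' ?Y (trail \<sigma>)"
      using continuous_map_pullback[OF continuous_map_id, of "topspace X" "trail \<sigma>" ?Y] by simp
    show "open_map ?X' ?Y (trail \<sigma>)"
      unfolding open_map_def
    proof (intro allI impI)
      fix U assume U: "openin ?X' U"
      obtain V where V: "openin ?Y V" "U = trail \<sigma> -` V \<inter> topspace X"
        using openX'[OF U] by blast
      have "trail \<sigma> ` U = V \<inter> topspace ?Y" unfolding V(2) img[symmetric] by auto
      then show "openin ?Y (trail \<sigma> ` U)" using V(1) openin_subset[OF V(1)] by (simp only: Int_absorb2)
    qed
    show "trail \<sigma> ` topspace ?X' = topspace ?Y" unfolding top by (rule img)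
    show "inj_on (trail \<sigma>) (topspace ?X')" unfolding top by (rule trail_inj[OF win])
  qed
  \<comment> \<open>The nodes here are histories, not elements of \<open>'a \<times> nat\<close>;
    \<open>ray_spaceI\<close> accepts a tree with nodes of any type.\<close>
  then have "ray_space ?X'"
    using ray_spaceI[OF histories_tree[OF win ne]] homeomorphic_map_imp_homeomorphic_space by blast
  with top coarser show ?thesis unfolding quasi_ray_space_def by blast
qed

theorem theorem4p8:
  fixes X :: "'a topology"
  assumes "topspace X \<noteq> {}"
  shows "quasi_ray_space X \<longleftrightarrow> (\<exists>\<sigma>. winning_strategy X \<sigma>)"
  using quasi_ray_space_imp_winning winning_imp_quasi_ray_space[OF assms] by blast

end
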